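(* Let $n\ge 3$ and $c\in(0,1)$, and let $M\in\mathcal{GT}(n_M,c_M)$ where $n_M\ge 3$ is an integer and $c_M\in(0,1)$ ($n_M$ and $c_M$ are possibly distinct from $n$ and $c$, respectively). Then the set $$\left\{a\in[1/4,1/3]: T_{a,c}\text{ admits a bi-Lipschitz embedding into }M\right\}$$ is at most countable. Moreover, for each $a\in[1/4,1/3]$, $T_{a,c}\in\mathcal{GT}(n,c)$.
   Context: A metric tree is a compact, connected, locally connected metric space containing no simple closed curve; equivalently every two distinct points $x,y$ are the endpoints of a unique arc $[x,y]_T$. A metric tree $T$ is geodesic if each arc $[x,y]_T$ is isometric to the interval $[0,d_T(x,y)]$. For $p\in T$, the connected components of $T\setminus\{p\}$ are the branches of $T$ at $p$, denoted $B_1^T(p),B_2^T(p),\ldots$ and arranged so that their diameters are nonincreasing; the valence $\operatorname{val}_T(p)$ is the number of these components, and $\operatorname{Val}(T)=\sup_{p\in T}\operatorname{val}_T(p)$. A point $p$ is a branch point if $\operatorname{val}_T(p)\ge 3$; its height is $H_T(p)=\operatorname{diam} B_3^T(p)$; $\mathcal B(T)$ is the set of branch points. For an integer $n\ge 2$ and $c\in(0,1]$, $\mathcal{GT}(n,c)$ is the class of geodesic metric trees $T$ with $\operatorname{Val}(T)\le n$ and uniformly relatively separated branch points with constant $c$, i.e. $d_T(p,q)\ge c\min\{H_T(p),H_T(q)\}$ for all distinct $p,q\in\mathcal B(T)$. A map $f:X\to Y$ between metric spaces is a bi-Lipschitz embedding if there are constants $k,K>0$ with $\frac1k d(x,y)\le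 d(f(x),f(y))\le K d(x,y)$ for all $x,y\in X$. Construction of $T_{a,c}$ for $a\in[1/4,1/3]$, $c\in(0,1)$: start with a line segment $I_0$ of length $1$, and attach at each of its two endpoints two line segments of length $c$; the result is $T_0^a$, and $I_0$ is its distinguished interval. Inductively, at each stage, every current distinguished interval $I$ is subdivided into three consecutive intervals of lengths $a|I|$, $(1-2a)|I|$, $a|I|$, and one new line segment of length $ca|I|$ is attached (by one of its endpoints) at each of the two interior subdivision points of $I$; the three subintervals become distinguished intervals for the next stage. The attached segments are never subdivided. This yields increasing sets $T_0^a\subset T_1^a\subset\cdots$, and $T_{a,c}=\bigcup_{k\ge0}T_k^a$ with the induced path metric (so distances are lengths of the unique connecting paths). *)

theory Defs
  imports "HOL-Analysis.Analysis" "HOL-Library.Extended_Nat"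
begin

section \<open>Geodesic metric trees\<close>

text \<open>A metric space is represented by a subset of a type of class \<^class>\<open>metric_space\<close>, with
  the restricted metric.\<close>

definition metric_tree :: "'a::metric_space set \<Rightarrow> bool" where
  "metric_tree T \<longleftrightarrow> compact T \<and> connected T \<and> locally connected T \<and>
     \<not> (\<exists>g. simple_path g \<and> pathfinish g = pathstart g \<and> path_image g \<subseteq> T)"

definition isometric :: "'a::metric_space set \<Rightarrow> 'b::metric_space set \<Rightarrow> bool" where
  "isometric X Y \<longleftrightarrow> (\<exists>f. f ` X = Y \<and> (\<forall>x\<in>X. \<forall>y\<in>X. dist (f x) (f y) = dist x y))"

definition geodesic_tree :: "'a::metric_space set \<Rightarrow> bool" where
  "geodesic_tree T \<longleftrightarrow> metric_tree T \<and>
     (\<forall>g. arc g \<and> path_image g \<subseteq> T \<longrightarrow>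
          isometric (path_image g) {0..dist (pathstart g) (pathfinish g)})"

abbreviation branches :: "'a::metric_space set \<Rightarrow> 'a \<Rightarrow> 'a set set" where
  "branches T p \<equiv> components (T - {p})"

definition valence :: "'a::metric_space set \<Rightarrow> 'a \<Rightarrow> enat" where
  "valence T p = (if finite (branches T p) then enat (card (branches T p)) else \<infinity>)"

definition Val :: "'a::metric_space set \<Rightarrow> enat" where
  "Val T = (SUP p\<in>T. valence T p)"

text \<open>The branches at a point are numbered from 1, with nonincreasing diameters. The numbering
  is unique only up to permuting branches of equal diameter; by \<open>branch_numbering_diameter\<close>
  below, the diameter of the third branch does not depend on it.\<close>

definition branch_numbering :: "'a::metric_space set \<Rightarrow> 'a \<Rightarrow> (nat \<Rightarrow> 'a set) \<Rightarrow> bool" where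
  "branch_numbering T p B \<longleftrightarrow>
     bij_betw B {i. 1 \<le> i \<and> enat i \<le> valence T p} (branches T p) \<and>
     (\<forall>i j. 1 \<le> i \<and> i \<le> j \<and> enat j \<le> valence T p \<longrightarrow> diameter (B j) \<le> diameter (B i))"

definition branch :: "'a::metric_space set \<Rightarrow> 'a \<Rightarrow> nat \<Rightarrow> 'a set" where
  "branch T p = (SOME B. branch_numbering T p B)"

definition branch_points :: "'a::metric_space set \<Rightarrow> 'a set" where
  "branch_points T = {p \<in> T. 3 \<le> valence T p}"

definition branch_height :: "'a::metric_space set \<Rightarrow> 'a \<Rightarrow> real" where
  "branch_height T p = diameter (branch T p 3)"

text \<open>The class written \<open>GT(n, c)\<close> in the literature.\<close>

definition geodesic_trees :: "nat \<Rightarrow> real \<Rightarrow> 'a::metric_space set set" where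
  "geodesic_trees n c = {T. geodesic_tree T \<and> Val T \<le> enat n \<and>
     (\<forall>p\<in>branch_points T. \<forall>q\<in>branch_points T. p \<noteq> q \<longrightarrow>
        dist p q \<ge> c * min (branch_height T p) (branch_height T q))}"

lemma branch_numbering_diameter_le:
  assumes B: "branch_numbering T p B" and B': "branch_numbering T p B'"
    and k: "1 \<le> k" "enat k \<le> valence T p"
  shows "diameter (B' k) \<le> diameter (B k)"
proof (rule ccontr)
  let ?I = "{i. 1 \<le> i \<and> enat i \<le> valence T p}"
  assume "\<not> ?thesis"
  then have less: "diameter (B k) < diameter (B' k)" by simp
  have sub: "{1..k} \<subseteq> ?I"
    using k by (auto intro: order_trans[of _ "enat k"])
  have inj: "inj_on B' {1..k}"
    using B' sub unfolding branch_numbering_def bij_betw_def by (blast intro: inj_on_subset)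
  have "B' ` {1..k} \<subseteq> B ` {1..<k}"
  proof
    fix C assume "C \<in> B' ` {1..k}"
    then obtain i where i: "i \<in> {1..k}" "C = B' i" by auto
    with B' k have big: "diameter (B k) < diameter C"
      using less unfolding branch_numbering_def by (force intro: less_le_trans)
    have "C \<in> branches T p"
      using B' i sub unfolding branch_numbering_def bij_betw_def by blast
    then obtain j where j: "j \<in> ?I" "C = B j"
      using B unfolding branch_numbering_def bij_betw_def by blast
    have "j < k"
    proof (rule ccontr)
      assume "\<not> j < k"
      then have "diameter (B j) \<le> diameter (B k)"
        using B j k unfolding branch_numbering_def by simp
      with big j show False by simp
    qed
    with j show "C \<in> B ` {1..<k}" by auto
  qed
  then have "card (B' ` {1..k}) \<le> card {1..<k}"
    by (meson card_image_le card_mono finite_atLeastLessThan finite_imageI order_trans)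
  with inj k show False by (simp add: card_image)
qed

lemma branch_numbering_diameter:
  assumes "branch_numbering T p B" "branch_numbering T p B'"
    and "1 \<le> k" "enat k \<le> valence T p"
  shows "diameter (B k) = diameter (B' k)"
  using assms by (intro antisym branch_numbering_diameter_le)

section \<open>Bi-Lipschitz embeddings\<close>

definition bi_Lipschitz_embedding ::
    "'a::metric_space set \<Rightarrow> 'b::metric_space set \<Rightarrow> ('a \<Rightarrow> 'b) \<Rightarrow> bool" where
  "bi_Lipschitz_embedding X Y f \<longleftrightarrow> f ` X \<subseteq> Y \<and>
     (\<exists>k K. k > 0 \<and> K > 0 \<and> (\<forall>x\<in>X. \<forall>y\<in>X.
        1 / k * dist x y \<le> dist (f x) (f y) \<and> dist (f x) (f y) \<le> K * dist x y))"

section \<open>The trees \<open>T\<^bsub>a,c\<^esub>\<close>\<close>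

text \<open>The trees \<open>T\<^bsub>a,c\<^esub>\<close> are realised inside the plane with the river metric: the real axis is a
  line (the river), at each of whose points two vertical rays are attached, one pointing upwards
  and one pointing downwards. The distance of two points is the length of the unique path joining
  them, so that on every connected subset the restricted metric is the induced path metric.\<close>

datatype river = River (abscissa: real) (ordinate: real)

instantiation river :: metric_space
begin

definition dist_river :: "river \<Rightarrow> river \<Rightarrow> real" where
  "dist_river p q =
     (if abscissa p = abscissa q then \<bar>ordinate p - ordinate q\<bar>
      else \<bar>ordinate p\<bar> + \<bar>abscissa p - abscissa q\<bar> + \<bar>ordinate q\<bar>)"

definition uniformity_river :: "(river \<times> river) filter" where
  "uniformity_river = (INF e\<in>{0<..}. principal {(x, y). dist x y < e})"

definition open_river :: "river set \<Rightarrow> bool" where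
  "open_river U = (\<forall>x\<in>U. \<forall>\<^sub>F (x', y) in uniformity. x' = x \<longrightarrow> y \<in> U)"

instance
proof
  fix p q r :: river
  show "dist p q = 0 \<longleftrightarrow> p = q"
    by (cases p; cases q) (auto simp: dist_river_def)
  show "dist p q \<le> dist p r + dist q r"
    unfolding dist_river_def by (smt (verit))
qed (simp_all add: uniformity_river_def open_river_def)

end

text \<open>The pair \<open>(l, r)\<close> stands for the interval \<open>[l, r]\<close> of the initial segment
  \<open>I\<^sub>0 = [0, 1]\<close>, which is placed on the real axis.\<close>

fun distinguished :: "real \<Rightarrow> nat \<Rightarrow> (real \<times> real) set" where
  "distinguished a 0 = {(0, 1)}"
| "distinguished a (Suc k) =
     (\<Union>(l, r)\<in>distinguished a k.
        {(l, l + a * (r - l)), (l + a * (r - l), r - a * (r - l)), (r - a * (r - l), r)})"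

text \<open>The two segments attached to an endpoint of \<open>I\<^sub>0\<close> are the upward and the downward vertical
  segment; all segments attached later point upwards.\<close>

fun tree_stage :: "real \<Rightarrow> real \<Rightarrow> nat \<Rightarrow> river set" where
  "tree_stage a c 0 =
     {River x 0 |x. 0 \<le> x \<and> x \<le> 1} \<union>
     {River x s |x s. x \<in> {0, 1} \<and> 0 \<le> s \<and> s \<le> c} \<union>
     {River x (- s) |x s. x \<in> {0, 1} \<and> 0 \<le> s \<and> s \<le> c}"
| "tree_stage a c (Suc k) =
     tree_stage a c k \<union>
     (\<Union>(l, r)\<in>distinguished a k.
        {River x s |x s. x \<in> {l + a * (r - l), r - a * (r - l)} \<and>
                          0 \<le> s \<and> s \<le> c * a * (r - l)})"

definition T_tree :: "real \<Rightarrow> real \<Rightarrow> river set" where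
  "T_tree a c = (\<Union>k. tree_stage a c k)"

end

theory Submission
  imports Defs
begin

text \<open>
  That the trees \<open>T\<^bsub>a,c\<^esub>\<close> belong to the class is a computation in the river metric. A connected
  subset of the plane that is closed under passing to the connecting paths is a geodesic tree as soon
  as it is compact, and its branches at a point correspond to the directions at that point that it
  occupies (\<open>comb_geodesic_tree\<close>, \<open>comb_same_branch_iff\<close>). The branch points of \<open>T\<^bsub>a,c\<^esub>\<close> are the points
  of the river at which a segment is attached; two of them are at least as far apart as the shorter of
  the attached segments is long (\<open>teeth_separated\<close>).

  For countability, let \<open>f\<close> embed \<open>T\<^bsub>a,c\<^esub>\<close> into \<open>M\<close>. The segments attached to the river make the
  image of every subdivision point a branch point of \<open>M\<close>, with height comparable to the length of the
  subdivided interval (\<open>birth_image_branch_point\<close>). This needs some topology of \<open>M\<close>: three arcs that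
  meet only in a point \<open>z\<close> lead into three different branches at \<open>z\<close>. For otherwise two of their end
  points could be joined by an arc avoiding \<open>z\<close>, by the theorem that connected open subsets of compact
  locally connected spaces are path connected, and \<open>M\<close> would contain a simple closed curve.

  The distinguished intervals of \<open>T\<^bsub>a,c\<^esub>\<close> and \<open>T\<^bsub>b,c\<^esub>\<close> correspond to each other through their
  addresses. Suppose that two embeddings \<open>f\<close> and \<open>g\<close> with the same constant map intervals with the
  same address to the same arc of \<open>M\<close>, that both stretch the interval nearly as much as any other
  interval, and that \<open>a\<close> and \<open>b\<close> are close. No subinterval can be stretched much more, so \<open>f\<close> and
  \<open>g\<close> subdivide the arc nearly in the ratios \<open>a : 1 - 2 a : a\<close> and \<open>b : 1 - 2 b : b\<close>. Corresponding
  subdivision points thus have images which are close to each other; being branch points of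
  comparable height in a tree with relatively separated branch points, they must coincide. So the
  three children match as well (\<open>matching_passes_to_children\<close>).

  If \<open>a \<noteq> b\<close>, one of the children increases the product of the two stretch factors by a fixed factor
  larger than 1, because the affinity \<open>2 sqrt (a b) + sqrt ((1 - 2 a) (1 - 2 b))\<close> is less than 1. The
  product, and hence each of the two stretch factors, is then again nearly maximal, so the step can be
  repeated until the product exceeds its bound. Hence \<open>a = b\<close>
  (\<open>common_data_determines_parameter\<close>). The hypotheses of this argument concern the constant of the
  embedding, an approximate value of the parameter, the address of one nearly maximally stretched
  interval and the images of its two ends. These are countably many possibilities, since \<open>M\<close> has only
  countably many branch points of positive height.
\<close>

section \<open>Path connectedness of locally connected compact spaces\<close>

text \<open>Local connectedness gives every point a small connected neighbourhood; a Lebesgue number of the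
  cover by these neighbourhoods makes the radius uniform.\<close>

lemma uniformly_locally_connected:
  fixes M :: "'a::metric_space set"
  assumes M: "compact M" "locally connected M" and e: "0 < e"
  obtains d where "0 < d"
    "\<And>p q. \<lbrakk>p \<in> M; q \<in> M; dist p q < d\<rbrakk> \<Longrightarrow>
        \<exists>C. connected C \<and> C \<subseteq> M \<and> p \<in> C \<and> q \<in> C \<and> (\<forall>x\<in>C. dist p x < e)"
proof -
  define \<V> where "\<V> = {V. open V \<and> connected (M \<inter> V) \<and> (\<forall>x\<in>M \<inter> V. \<forall>y\<in>M \<inter> V. dist x y < e)}"
  have "M \<subseteq> \<Union>\<V>"
  proof
    fix x assume x: "x \<in> M"
    have "openin (top_of_set M) (M \<inter> ball x (e/2))" by auto
    with x e M(2) obtain u where u: "openin (top_of_set M) u" "connected u" "x \<in> u" "u \<subseteq> M \<inter> ball x (e/2)"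
      unfolding locally_connected by (metis IntI centre_in_ball half_gt_zero)
    then obtain V where V: "open V" "u = M \<inter> V" by (metis openin_open)
    have "dist y z < e" if "y \<in> u" "z \<in> u" for y z
    proof -
      have "dist x y < e/2" "dist x z < e/2" using that u by auto
      then show ?thesis using dist_triangle3[of y z x] by linarith
    qed
    then have "V \<in> \<V>" using V(1) u(2) unfolding \<V>_def V(2) by blast
    then show "x \<in> \<Union>\<V>" using V u by blast
  qed
  then obtain d where d: "0 < d" "\<And>x. x \<in> M \<Longrightarrow> \<exists>V\<in>\<V>. ball x d \<subseteq> V"
  proof (rule Heine_Borel_lemma[OF M(1)])
    show "open V" if "V \<in> \<V>" for V using that by (simp add: \<V>_def)
  qed blast
  show thesis
  proof (rule that[OF d(1)])
    fix p q assume pq: "p \<in> M" "q \<in> M" "dist p q < d"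
    then obtain V where V: "V \<in> \<V>" "ball p d \<subseteq> V" using d by blast
    then have "p \<in> V" "q \<in> V" using pq d by auto
    then show "\<exists>C. connected C \<and> C \<subseteq> M \<and> p \<in> C \<and> q \<in> C \<and> (\<forall>x\<in>C. dist p x < e)"
      using V pq by (intro exI[of _ "M \<inter> V"]) (auto simp: \<V>_def)
  qed
qed

lemma connected_imp_chain:
  fixes C :: "'a::metric_space set"
  assumes C: "connected C" "p \<in> C" "q \<in> C" and d: "0 < d"
  shows "(p, q) \<in> {(x, y). x \<in> C \<and> y \<in> C \<and> dist x y < d}\<^sup>*" (is "_ \<in> ?R\<^sup>*")
proof (rule connected_equivalence_relation[OF C, where R = "\<lambda>x y. (x, y) \<in> ?R\<^sup>*"])
  fix x y assume xy: "(x, y) \<in> ?R\<^sup>*"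
  have "sym ?R" by (auto simp: sym_def dist_commute)
  from symD[OF sym_rtrancl[OF this] xy] show "(y, x) \<in> ?R\<^sup>*" .
next
  fix x assume "x \<in> C"
  have "(x, y) \<in> ?R\<^sup>*" if "y \<in> C \<inter> ball x d" for y
    by (rule r_into_rtrancl) (use that \<open>x \<in> C\<close> in simp)
  then show "\<exists>T. openin (top_of_set C) T \<and> x \<in> T \<and> (\<forall>y\<in>T. (x, y) \<in> ?R\<^sup>*)"
    using \<open>x \<in> C\<close> d by (intro exI[of _ "C \<inter> ball x d"]) auto
qed (rule rtrancl_trans)

text \<open>In a shortest chain, two points of the same colour would be joined by one step, so they are
  consecutive or equal. Hence the points with even index have pairwise distinct colours, and their
  number is at most the number of colours.\<close>

lemma relpow_shorten:
  fixes R :: "('a \<times> 'a) set" and \<phi> :: "'a \<Rightarrow> 'b"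
  assumes pq: "(p, q) \<in> R\<^sup>*" and fin: "finite F" "\<phi> ` (Field R) \<subseteq> F"
    and R: "\<And>x y. x \<in> Field R \<Longrightarrow> y \<in> Field R \<Longrightarrow> \<phi> x = \<phi> y \<Longrightarrow> (x, y) \<in> R"
  shows "\<exists>n \<le> 2 * card F. (p, q) \<in> R ^^ n"
proof -
  obtain n0 where "(p, q) \<in> R ^^ n0" using pq by (meson rtrancl_imp_relpow)
  define n where "n = (LEAST n. (p, q) \<in> R ^^ n)"
  have n: "(p, q) \<in> R ^^ n" unfolding n_def by (rule LeastI) fact
  have least: "n \<le> m" if "(p, q) \<in> R ^^ m" for m unfolding n_def by (rule Least_le) fact
  obtain c where c: "c 0 = p" "c n = q" "\<And>i. i < n \<Longrightarrow> (c i, c (Suc i)) \<in> R"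
    using n unfolding relpow_fun_conv by blast
  have seg: "(c i, c (i + k)) \<in> R ^^ k" if "i + k \<le> n" for i k
    using that c(3) by (induction k) (auto intro: relpow_Suc_I)
  \<comment> \<open>Equal colours at the indices \<open>2 * i < 2 * j\<close> would give a shortcut.\<close>
  have inj: "inj_on (\<lambda>k. \<phi> (c (2 * k))) {k. 2 * k < n}"
  proof (rule linorder_inj_onI)
    fix i j assume ij: "i < j" "i \<in> {k. 2 * k < n}" "j \<in> {k. 2 * k < n}"
    show "\<phi> (c (2 * i)) \<noteq> \<phi> (c (2 * j))"
    proof
      assume "\<phi> (c (2 * i)) = \<phi> (c (2 * j))"
      moreover have "c (2 * i) \<in> Field R" "c (2 * j) \<in> Field R"
        using c(3)[of "2*i"] c(3)[of "2*j"] ij by (auto simp: Field_def)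
      ultimately have "(c (2 * i), c (2 * j)) \<in> R ^^ 1" using R by simp
      moreover have "(p, c (2 * i)) \<in> R ^^ (2 * i)" using seg[of 0 "2 * i"] ij c by simp
      moreover have "(c (2 * j), q) \<in> R ^^ (n - 2 * j)" using seg[of "2 * j" "n - 2 * j"] ij c by simp
      ultimately have "(p, q) \<in> R ^^ (2 * i + 1 + (n - 2 * j))"
        unfolding relpow_add by blast
      then show False using least ij by fastforce
    qed
  qed auto
  have "(\<lambda>k. \<phi> (c (2 * k))) ` {k. 2 * k < n} \<subseteq> F"
    using c(3) fin(2) by (fastforce simp: Field_def)
  then have "card {k. 2 * k < n} \<le> card F" using inj fin(1) by (metis card_inj_on_le)
  moreover have "{k. 2 * k < n} = {..<(n + 1) div 2}" by auto
  ultimately have "n \<le> 2 * card F" by simp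
  then show ?thesis using n by blast
qed

text \<open>Colouring the points by the balls of a finite cover bounds the length of a shortest chain,
  uniformly over all connected subsets. A shorter chain is padded by repeating its last point, so
  that all chains get the same number of steps; this makes the parametrization below a matter of
  integer division.\<close>

lemma chains_of_uniform_length:
  fixes M :: "'a::metric_space set"
  assumes M: "compact M" and d: "0 < d"
  obtains N where "1 \<le> N"
    "\<And>C p q. \<lbrakk>connected C; C \<subseteq> M; p \<in> C; q \<in> C\<rbrakk> \<Longrightarrow>
       \<exists>c. c 0 = p \<and> c N = q \<and> (\<forall>i\<le>N. c i \<in> C) \<and> (\<forall>i<N. dist (c i) (c (Suc i)) < d)"
proof -
  obtain F where F: "finite F" "M \<subseteq> (\<Union>x\<in>F. ball x (d/2))"
    using compactE_image[OF M, of M "\<lambda>x. ball x (d/2)"] d by (metis UN_I centre_in_ball half_gt_zero open_ball subsetI)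
  define \<phi> where "\<phi> y = (SOME x. x \<in> F \<and> y \<in> ball x (d/2))" for y
  have \<phi>: "\<phi> y \<in> F \<and> y \<in> ball (\<phi> y) (d/2)" if "y \<in> M" for y
    unfolding \<phi>_def by (rule someI_ex) (use that F in blast)
  show thesis
  proof (rule that[of "2 * card F + 1"])
    fix C p q assume C: "connected C" "C \<subseteq> M" "p \<in> C" "q \<in> C"
    define R where "R = {(x, y). x \<in> C \<and> y \<in> C \<and> dist x y < d}"
    have Field: "Field R \<subseteq> C" by (auto simp: R_def Field_def)
    have "(p, q) \<in> R\<^sup>*" unfolding R_def by (rule connected_imp_chain) (use C d in auto)
    moreover have "\<phi> ` Field R \<subseteq> F" using Field C \<phi> by blast
    moreover have "(x, y) \<in> R" if "x \<in> Field R" "y \<in> Field R" "\<phi> x = \<phi> y" for x y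
    proof -
      have "dist (\<phi> x) x < d/2" "dist (\<phi> x) y < d/2" using \<phi> that Field C by (metis mem_ball subsetD)+
      then have "dist x y < d" using dist_triangle3[of x y "\<phi> x"] by linarith
      then show ?thesis using that Field by (auto simp: R_def)
    qed
    ultimately obtain n where n: "n \<le> 2 * card F" "(p, q) \<in> R ^^ n"
      using relpow_shorten[of p q R F \<phi>] F(1) by blast
    then obtain c where c: "c 0 = p" "c n = q" "\<And>i. i < n \<Longrightarrow> (c i, c (Suc i)) \<in> R"
      unfolding relpow_fun_conv by blast
    have cC: "c i \<in> C" if "i \<le> n" for i
      using c(2) C(4) c(3)[of i] that by (cases "i = n") (auto simp: R_def)
    show "\<exists>c. c 0 = p \<and> c (2 * card F + 1) = q \<and> (\<forall>i\<le>2 * card F + 1. c i \<in> C) \<and>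
          (\<forall>i<2 * card F + 1. dist (c i) (c (Suc i)) < d)"
    proof (intro exI[of _ "\<lambda>i. c (min i n)"] conjI allI impI)
      fix i
      show "dist (c (min i n)) (c (min (Suc i) n)) < d"
        using c(3)[of i] d by (cases "i < n") (auto simp: R_def)
    qed (use c n cC in auto)
  qed auto
qed

lemma nat_floor_mult_div:
  fixes x :: real
  assumes "0 \<le> x" "1 \<le> N"
  shows "nat \<lfloor>x * real N\<rfloor> div N = nat \<lfloor>x\<rfloor>"
proof -
  have "\<lfloor>x * real N\<rfloor> div int N = \<lfloor>x\<rfloor>"
    using floor_divide_real_eq_div[of "int N" "x * real N"] assms by simp
  then show ?thesis using assms
    by (metis nat_div_as_int nat_int int_nat_eq mult_nonneg_nonneg of_nat_0_le_iff zero_le_floor)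
qed

text \<open>Close points are joined by a small connected set, hence by a chain in it with steps so small
  that consecutive points again lie in a common, much smaller, connected set, and so on. The chains
  of level \<open>k\<close> are subdivided into \<open>N k\<close> steps, so that \<open>s k\<close> is a sequence of
  \<open>L k = N 0 * ... * N (k - 1)\<close> steps refining \<open>s (k - 1)\<close>. The sequences, read as step functions
  on \<open>[0, 1]\<close>, converge uniformly to a path because the sizes of the connected sets form a
  geometric series.\<close>

lemma path_by_refined_chains:
  fixes M :: "'a::metric_space set"
  assumes M: "compact M" "locally connected M" and r: "0 < r"
  obtains d where "0 < d"
    "\<And>x y. \<lbrakk>x \<in> M; y \<in> M; dist x y < d\<rbrakk> \<Longrightarrow>
        \<exists>g. path g \<and> path_image g \<subseteq> M \<inter> ball x r \<and> pathstart g = x \<and> pathfinish g = y"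
proof -
  \<comment> \<open>The sum of the series is r/2, which leaves room for staying within distance r of x.\<close>
  define e where "e k = r / 4 * (1/2) ^ k" for k :: nat
  have e0: "0 < e k" for k using r by (simp add: e_def)
  define G where "G k p q \<longleftrightarrow> (\<exists>C. connected C \<and> C \<subseteq> M \<and> p \<in> C \<and> q \<in> C \<and> (\<forall>x\<in>C. dist p x < e k))" for k p q
  have "\<exists>d>0. \<forall>p\<in>M. \<forall>q\<in>M. dist p q < d \<longrightarrow> G k p q" for k
    using uniformly_locally_connected[OF M e0[of k]] unfolding G_def by metis
  then obtain \<delta> where \<delta>: "\<And>k. 0 < \<delta> k"
      "\<And>k p q. \<lbrakk>p \<in> M; q \<in> M; dist p q < \<delta> k\<rbrakk> \<Longrightarrow> G k p q"
    by metis
  have "\<exists>N\<ge>1. \<forall>p q. G k p q \<longrightarrow>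
     (\<exists>c. c 0 = p \<and> c N = q \<and> (\<forall>i\<le>N. c i \<in> M \<and> dist p (c i) < e k) \<and> (\<forall>i<N. G (Suc k) (c i) (c (Suc i))))" for k
  proof -
    obtain N where N: "1 \<le> N"
     "\<And>C p q. \<lbrakk>connected C; C \<subseteq> M; p \<in> C; q \<in> C\<rbrakk> \<Longrightarrow>
       \<exists>c. c 0 = p \<and> c N = q \<and> (\<forall>i\<le>N. c i \<in> C) \<and> (\<forall>i<N. dist (c i) (c (Suc i)) < \<delta> (Suc k))"
      using chains_of_uniform_length[OF M(1) \<delta>(1)[of "Suc k"]] by metis
    show ?thesis
    proof (intro exI[of _ N] conjI allI impI)
      fix p q assume "G k p q"
      then obtain C where C: "connected C" "C \<subseteq> M" "p \<in> C" "q \<in> C" "\<And>x. x\<in>C \<Longrightarrow> dist p x < e k"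
        unfolding G_def by blast
      obtain c where c: "c 0 = p" "c N = q" "\<And>i. i\<le>N \<Longrightarrow> c i \<in> C" "\<And>i. i<N \<Longrightarrow> dist (c i) (c (Suc i)) < \<delta> (Suc k)"
        using N(2)[OF C(1-4)] by blast
      have "G (Suc k) (c i) (c (Suc i))" if "i < N" for i
        using that c(3)[of i] c(3)[of "Suc i"] c(4)[of i] C(2) by (intro \<delta>(2)) auto
      then show "\<exists>c. c 0 = p \<and> c N = q \<and> (\<forall>i\<le>N. c i \<in> M \<and> dist p (c i) < e k) \<and> (\<forall>i<N. G (Suc k) (c i) (c (Suc i)))"
        using c C by (intro exI[of _ c]) auto
    qed (use N in simp)
  qed
  then obtain N where N: "\<And>k. 1 \<le> N k" "\<And>k p q. G k p q \<Longrightarrow>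
     \<exists>c. c 0 = p \<and> c (N k) = q \<and> (\<forall>i\<le>N k. c i \<in> M \<and> dist p (c i) < e k) \<and> (\<forall>i<N k. G (Suc k) (c i) (c (Suc i)))"
    by metis
  \<comment> \<open>The choice is made total, with the first point always p, because the refined sequence below is
    also evaluated one step past its end.\<close>
  define good where "good k p q c \<longleftrightarrow> c 0 = p \<and> (G k p q \<longrightarrow> c (N k) = q \<and>
     (\<forall>i\<le>N k. c i \<in> M \<and> dist p (c i) < e k) \<and> (\<forall>i<N k. G (Suc k) (c i) (c (Suc i))))" for k p q c
  define ch where "ch k p q = (SOME c. good k p q c)" for k p q
  have "\<exists>c. good k p q c" for k p q
  proof (cases "G k p q")
    case True
    then show ?thesis using N(2)[OF True] unfolding good_def by blast
  next
    case False
    then show ?thesis by (intro exI[of _ "\<lambda>_. p"]) (simp add: good_def)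
  qed
  then have good: "good k p q (ch k p q)" for k p q unfolding ch_def by (rule someI_ex)
  have ch0: "ch k p q 0 = p" for k p q using good[of k p q] by (simp add: good_def)
  have ch: "\<And>k p q. G k p q \<Longrightarrow> ch k p q (N k) = q"
      "\<And>k p q i. G k p q \<Longrightarrow> i \<le> N k \<Longrightarrow> ch k p q i \<in> M \<and> dist p (ch k p q i) < e k"
      "\<And>k p q i. G k p q \<Longrightarrow> i < N k \<Longrightarrow> G (Suc k) (ch k p q i) (ch k p q (Suc i))"
    using good unfolding good_def by blast+
  define L where "L k = (\<Prod>i<k. N i)" for k
  have L1: "1 \<le> L k" for k unfolding L_def using N(1) by (auto simp: Suc_le_eq intro!: prod_pos)
  have LSuc: "L (Suc k) = L k * N k" for k by (simp add: L_def)
  have main: "\<exists>g. path g \<and> path_image g \<subseteq> M \<inter> ball x r \<and> pathstart g = x \<and> pathfinish g = y"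
    if xy: "x \<in> M" "y \<in> M" "dist x y < \<delta> 0" for x y
  proof -
    \<comment> \<open>The point number j of level k + 1 lies on the chain that replaces the step number j div N k.\<close>
    define s where "s = rec_nat (\<lambda>i. if i = 0 then x else y)
        (\<lambda>k sk j. ch k (sk (j div N k)) (sk (Suc (j div N k))) (j mod N k))"
    have s0: "s 0 = (\<lambda>i. if i = 0 then x else y)" by (simp add: s_def)
    have sSuc: "s (Suc k) j = ch k (s k (j div N k)) (s k (Suc (j div N k))) (j mod N k)" for k j
      by (simp add: s_def)
    have N0: "0 < N k" for k using N(1)[of k] by simp
    have smult: "s (Suc k) (i * N k) = s k i" for k i
      using N0[of k] by (simp add: sSuc ch0)
    have sG: "i < L k \<Longrightarrow> G k (s k i) (s k (Suc i))" for k i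
    proof (induction k arbitrary: i)
      case 0
      then show ?case using xy \<delta>(2)[of x y 0] by (simp add: L_def s0)
    next
      case (Suc k)
      let ?d = "i div N k" and ?m = "i mod N k"
      have "?d < L k" using Suc.prems N0[of k] by (simp add: LSuc less_mult_imp_div_less)
      note G = Suc.IH[OF this]
      have m: "?m < N k" using N0 by simp
      have "s (Suc k) (Suc i) = ch k (s k ?d) (s k (Suc ?d)) (Suc ?m)"
      proof (cases "Suc ?m = N k")
        case True
        then have "Suc i = Suc ?d * N k"
          by (metis add.commute add_Suc div_mult_mod_eq mult_Suc plus_1_eq_Suc add.assoc)
        then have "s (Suc k) (Suc i) = s k (Suc ?d)" by (simp only: smult)
        then show ?thesis using ch(1)[OF G] True by simp
      next
        case False
        then have "Suc i div N k = ?d" "Suc i mod N k = Suc ?m"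
          by (simp_all add: div_Suc mod_Suc)
        then show ?thesis by (simp add: sSuc)
      qed
      moreover have "s (Suc k) i = ch k (s k ?d) (s k (Suc ?d)) ?m" by (rule sSuc)
      ultimately show ?case using ch(3)[OF G m] by simp
    qed
    have sL: "s k (L k) = y" for k
    proof (induction k)
      case (Suc k)
      then show ?case using smult[of k "L k"] by (simp add: LSuc)
    qed (simp add: s0 L_def)
    have sM: "s k i \<in> M" if "i \<le> L k" for k i
    proof (cases "i = L k")
      case True
      then show ?thesis using sL xy by simp
    next
      case False
      then show ?thesis using sG[of i k] that by (auto simp: G_def)
    qed
    have s00: "s k 0 = x" for k
    proof (induction k)
      case (Suc k)
      then show ?case using smult[of k 0] by simp
    qed (simp add: s0)
    have step: "dist (s (Suc k) j) (s k (j div N k)) < e k" if "j \<le> L (Suc k)" for k j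
    proof (cases "j = L (Suc k)")
      case True
      then have "j div N k = L k" using N0[of k] by (simp add: LSuc)
      then show ?thesis using True sL e0 by simp
    next
      case False
      then have "j div N k < L k" using that N0[of k] by (simp add: LSuc less_mult_imp_div_less)
      from ch(2)[OF sG[OF this], of "j mod N k"] show ?thesis
        using N0[of k] by (simp add: sSuc dist_commute less_imp_le)
    qed
    define u where "u k t = s k (nat \<lfloor>t * real (L k)\<rfloor>)" for k and t :: real
    have idx: "nat \<lfloor>t * real (L k)\<rfloor> \<le> L k" if "t \<in> {0..1}" for t k
    proof -
      have "t * real (L k) \<le> real (L k)" using that by (simp add: mult_left_le_one_le)
      then have "\<lfloor>t * real (L k)\<rfloor> \<le> int (L k)" by linarith
      then show ?thesis by linarith
    qed
    have uM: "u k t \<in> M" if "t \<in> {0..1}" for k t unfolding u_def using sM idx that by blast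
    have ustep: "dist (u (Suc k) t) (u k t) < e k" if t: "t \<in> {0..1}" for k t
    proof -
      have "nat \<lfloor>t * real (L (Suc k))\<rfloor> div N k = nat \<lfloor>t * real (L k)\<rfloor>"
        using nat_floor_mult_div[of "t * real (L k)" "N k"] t N(1)[of k] by (simp add: LSuc mult.assoc)
      then show ?thesis unfolding u_def using step[OF idx[OF t, of "Suc k"]] by simp
    qed
    have ufar: "dist (u (k + j) t) (u k t) \<le> 2 * e k - 2 * e (k + j)" if t: "t \<in> {0..1}" for k j t
    proof (induction j)
      case (Suc j)
      have "dist (u (k + Suc j) t) (u k t) \<le> dist (u (Suc (k + j)) t) (u (k + j) t) + dist (u (k + j) t) (u k t)"
        by (metis dist_triangle add_Suc_right)
      also have "\<dots> \<le> e (k + j) + (2 * e k - 2 * e (k + j))"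
        using Suc.IH ustep[OF t, of "k + j"] by linarith
      also have "\<dots> = 2 * e k - 2 * e (k + Suc j)" by (simp add: e_def)
      finally show ?case .
    qed simp
    have elim: "e \<longlonglongrightarrow> 0"
      unfolding e_def by (intro tendsto_mult_right_zero LIMSEQ_power_zero) simp
    have esmall: "\<exists>k. e k < c" if "0 < c" for c
      using order_tendstoD(2)[OF elim that] unfolding eventually_sequentially by blast
    have "\<exists>l. l \<in> M \<and> (\<lambda>k. u k t) \<longlonglongrightarrow> l" if t: "t \<in> {0..1}" for t
    proof -
      have "Cauchy (\<lambda>k. u k t)"
      proof (rule metric_CauchyI)
        fix \<epsilon> :: real assume "0 < \<epsilon>"
        then obtain k where k: "e k < \<epsilon> / 4" using esmall[of "\<epsilon> / 4"] by auto
        have "dist (u m t) (u n t) < \<epsilon>" if "k \<le> m" "k \<le> n" for m n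
          using ufar[OF t, of k "m - k"] ufar[OF t, of k "n - k"] that k e0[of m] e0[of n]
            dist_triangle2[of "u m t" "u n t" "u k t"] by simp
        then show "\<exists>K. \<forall>m\<ge>K. \<forall>n\<ge>K. dist (u m t) (u n t) < \<epsilon>" by blast
      qed
      then show ?thesis using compact_imp_complete[OF M(1)] uM[OF t] by (metis completeE)
    qed
    then obtain g where g: "\<And>t. t \<in> {0..1} \<Longrightarrow> g t \<in> M \<and> (\<lambda>k. u k t) \<longlonglongrightarrow> g t" by metis
    have gu: "dist (g t) (u k t) \<le> 2 * e k" if t: "t \<in> {0..1}" for t k
    proof (rule LIMSEQ_le_const2)
      show "(\<lambda>n. dist (u n t) (u k t)) \<longlonglongrightarrow> dist (g t) (u k t)"
        using g[OF t] by (intro tendsto_intros) auto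
      have "dist (u n t) (u k t) \<le> 2 * e k" if "k \<le> n" for n
        using ufar[OF t, of k "n - k"] that e0[of n] by simp
      then show "\<exists>N. \<forall>n\<ge>N. dist (u n t) (u k t) \<le> 2 * e k" by blast
    qed
    have near: "dist (u k t) (u k t') < e k" if t: "t \<in> {0..1}" "t' \<in> {0..1}" "t \<le> t'" "t' - t < 1 / L k" for k t t'
    proof -
      have "t' * L k < t * L k + 1" using that(4) L1[of k] by (simp add: field_simps)
      moreover have "t * L k \<le> t' * L k" using that L1[of k] by simp
      ultimately have "\<lfloor>t' * L k\<rfloor> = \<lfloor>t * L k\<rfloor> \<or> \<lfloor>t' * L k\<rfloor> = \<lfloor>t * L k\<rfloor> + 1"
        by linarith
      moreover have "0 \<le> \<lfloor>t * L k\<rfloor>" using t by simp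
      ultimately have "nat \<lfloor>t' * L k\<rfloor> = nat \<lfloor>t * L k\<rfloor> \<or> nat \<lfloor>t' * L k\<rfloor> = Suc (nat \<lfloor>t * L k\<rfloor>)"
        by (auto simp: nat_add_distrib)
      then consider "nat \<lfloor>t' * L k\<rfloor> = nat \<lfloor>t * L k\<rfloor>" | "nat \<lfloor>t' * L k\<rfloor> = Suc (nat \<lfloor>t * L k\<rfloor>)"
        by blast
      then show ?thesis
      proof cases
        case 1
        then show ?thesis using e0 by (simp add: u_def)
      next
        case 2
        then have "nat \<lfloor>t * L k\<rfloor> < L k" using idx[OF t(2), of k] by simp
        from sG[OF this] show ?thesis unfolding u_def 2 G_def by blast
      qed
    qed
    have gnear: "dist (g t) (g t') < 5 * e k" if t: "t \<in> {0..1}" "t' \<in> {0..1}" "\<bar>t' - t\<bar> < 1 / L k" for k t t'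
    proof -
      have "dist (u k t) (u k t') < e k"
        using near[of t t' k] near[of t' t k] t by (cases "t \<le> t'") (auto simp: dist_commute)
      then show ?thesis using gu[OF t(1), of k] gu[OF t(2), of k]
         dist_triangle2[of "g t" "g t'" "u k t'"] dist_triangle[of "g t" "u k t'" "u k t"] by linarith
    qed
    have "path g"
      unfolding path_def continuous_on_iff
    proof (intro ballI allI impI)
      fix t \<epsilon> :: real assume t: "t \<in> {0..1}" and "0 < \<epsilon>"
      then obtain k where k: "e k < \<epsilon> / 5" using esmall[of "\<epsilon> / 5"] by auto
      show "\<exists>d>0. \<forall>x'\<in>{0..1}. dist x' t < d \<longrightarrow> dist (g x') (g t) < \<epsilon>"
        using gnear[OF t, of _ k] k L1[of k]
        by (intro exI[of _ "1 / L k"]) (force simp: dist_real_def dist_commute)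
    qed
    moreover have "g 0 = x"
      using g[of 0] by (simp add: u_def s00 LIMSEQ_const_iff)
    moreover have "g 1 = y"
      using g[of 1] by (simp add: u_def sL LIMSEQ_const_iff)
    moreover have "g t \<in> M \<inter> ball x r" if t: "t \<in> {0..1}" for t
    proof -
      have xy': "dist x y < e 0" using sG[of 0 0] by (auto simp: G_def L_def s0)
      have "u 0 t \<in> {x, y}" by (simp add: u_def s0)
      then have "dist x (u 0 t) < e 0" using xy' e0[of 0] by auto
      then have "dist x (g t) < 3 * e 0"
        using gu[OF t, of 0] dist_triangle2[of x "g t" "u 0 t"] by linarith
      then show ?thesis using g[OF t] r by (simp add: e_def)
    qed
    ultimately show ?thesis
      unfolding pathstart_def pathfinish_def path_image_def by blast
  qed
  show thesis using that[OF \<delta>(1)[of 0] main] by blast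
qed

text \<open>This is the theorem of Mazurkiewicz, Moore and Menger for the compact case. It is what lets
  branches, which are defined by connectedness, be handled with paths.\<close>

lemma openin_connected_imp_path_connected:
  fixes M :: "'a::metric_space set"
  assumes M: "compact M" "locally connected M"
    and U: "openin (top_of_set M) U" "connected U" and xy: "x \<in> U" "y \<in> U"
  shows "\<exists>g. path g \<and> path_image g \<subseteq> U \<and> pathstart g = x \<and> pathfinish g = y"
proof -
  have nbhd: "\<exists>d>0. \<forall>z'\<in>U. dist z' z < d \<longrightarrow> path_component U z z'" if z: "z \<in> U" for z
  proof -
    obtain e where e: "0 < e" "\<And>z'. z' \<in> M \<Longrightarrow> dist z' z < e \<Longrightarrow> z' \<in> U"
      using U(1) z unfolding openin_euclidean_subtopology_iff by blast
    have UM: "U \<subseteq> M" using U(1) openin_imp_subset by blast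
    obtain d where d: "0 < d" "\<And>x y. \<lbrakk>x \<in> M; y \<in> M; dist x y < d\<rbrakk> \<Longrightarrow>
        \<exists>g. path g \<and> path_image g \<subseteq> M \<inter> ball x e \<and> pathstart g = x \<and> pathfinish g = y"
      using path_by_refined_chains[OF M e(1)] by metis
    have "path_component U z z'" if z': "z' \<in> U" "dist z' z < d" for z'
    proof -
      obtain g where g: "path g" "path_image g \<subseteq> M \<inter> ball z e" "pathstart g = z" "pathfinish g = z'"
        using d(2)[of z z'] z z' UM by (metis dist_commute subsetD)
      have "path_image g \<subseteq> U"
      proof
        fix w assume "w \<in> path_image g"
        then have "w \<in> M" "dist w z < e" using g(2) by (auto simp: dist_commute)
        then show "w \<in> U" by (rule e(2))
      qed
      then show ?thesis using g unfolding path_component_def by blast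
    qed
    then show ?thesis using d by blast
  qed
  have "path_component U x y"
  proof (rule connected_equivalence_relation[OF U(2) xy, where R = "path_component U"])
    fix z assume z: "z \<in> U"
    then obtain d where d: "d > 0" "\<And>z'. z' \<in> U \<Longrightarrow> dist z' z < d \<Longrightarrow> path_component U z z'"
      using nbhd[of z] by auto
    then have "\<forall>z'\<in>U \<inter> ball z d. path_component U z z'" by (auto simp: dist_commute)
    then show "\<exists>T. openin (top_of_set U) T \<and> z \<in> T \<and> (\<forall>z'\<in>T. path_component U z z')"
      using z d(1) by (intro exI[of _ "U \<inter> ball z d"]) auto
  qed (auto intro: path_component_trans path_component_sym)
  then show ?thesis unfolding path_component_def by blast
qed

section \<open>Arcs in metric spaces\<close>

text \<open>The Kuratowski embedding \<open>x \<mapsto> (y \<mapsto> dist x y - dist o' y)\<close>; subtracting the distance to a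
  base point makes the functions bounded.\<close>

lemma isometric_embedding_into_banach_space:
  "\<exists>\<iota> :: 'a::metric_space \<Rightarrow> ('a \<Rightarrow>\<^sub>C real). \<forall>x y. dist (\<iota> x) (\<iota> y) = dist x y"
proof -
  obtain o' :: 'a where True by simp
  define h where "h x y = dist x y - dist o' y" for x y :: 'a
  have bc: "h x \<in> bcontfun" for x
  proof -
    have "continuous_on UNIV (h x)" unfolding h_def by (intro continuous_intros)
    moreover have "bounded (range (h x))"
      unfolding bounded_iff h_def using abs_dist_diff_le by (metis (mono_tags, lifting) imageE real_norm_def dist_commute)
    ultimately show ?thesis by (simp add: bcontfun_def)
  qed
  define \<iota> where "\<iota> x = Bcontfun (h x)" for x
  have app: "apply_bcontfun (\<iota> x) y = h x y" for x y
    unfolding \<iota>_def using bc by (simp add: Bcontfun_inverse)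
  have "dist (\<iota> x) (\<iota> y) = dist x y" for x y
  proof (rule antisym)
    show "dist (\<iota> x) (\<iota> y) \<le> dist x y"
    proof (rule dist_bound)
      fix z show "dist (apply_bcontfun (\<iota> x) z) (apply_bcontfun (\<iota> y) z) \<le> dist x y"
        unfolding app h_def dist_real_def using abs_dist_diff_le[of x z y] by (simp add: dist_commute[of z y])
    qed
    have "dist (apply_bcontfun (\<iota> x) y) (apply_bcontfun (\<iota> y) y) \<le> dist (\<iota> x) (\<iota> y)"
      by (rule dist_bounded)
    then show "dist x y \<le> dist (\<iota> x) (\<iota> y)" by (simp add: app h_def dist_real_def)
  qed
  then show ?thesis by blast
qed

text \<open>A path contains an arc in any complete normed space, and the Kuratowski embedding transports
  this to metric spaces.\<close>

lemma path_contains_arc_metric: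
  fixes p :: "real \<Rightarrow> 'a::metric_space"
  assumes p: "path p" "pathstart p = a" "pathfinish p = b" and ab: "a \<noteq> b"
  obtains q where "arc q" "path_image q \<subseteq> path_image p" "pathstart q = a" "pathfinish q = b"
proof -
  obtain \<iota> :: "'a \<Rightarrow> ('a \<Rightarrow>\<^sub>C real)" where \<iota>: "\<And>x y. dist (\<iota> x) (\<iota> y) = dist x y"
    using isometric_embedding_into_banach_space by blast
  have inj: "inj \<iota>" using \<iota> by (metis dist_eq_0_iff injI)
  have cont: "continuous_on S \<iota>" for S unfolding continuous_on_iff using \<iota> by metis
  have "path (\<iota> \<circ> p)" using p(1) cont by (rule path_continuous_image)
  moreover have "pathstart (\<iota> \<circ> p) = \<iota> a" "pathfinish (\<iota> \<circ> p) = \<iota> b" "\<iota> a \<noteq> \<iota> b"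
    using p ab inj by (auto simp: pathstart_compose pathfinish_compose inj_eq)
  ultimately obtain q where q: "arc q" "path_image q \<subseteq> path_image (\<iota> \<circ> p)" "pathstart q = \<iota> a" "pathfinish q = \<iota> b"
    by (rule path_contains_arc)
  have im: "path_image q \<subseteq> range \<iota>" using q(2) by (auto simp: path_image_def)
  have cinv: "continuous_on (range \<iota>) (inv \<iota>)"
    unfolding continuous_on_iff by (auto simp: inv_f_f[OF inj] \<iota>)
  show thesis
  proof (rule that[of "inv \<iota> \<circ> q"])
    show "arc (inv \<iota> \<circ> q)"
      unfolding arc_def
    proof
      show "path (inv \<iota> \<circ> q)"
        using q(1) im cinv by (meson arc_imp_path path_continuous_image continuous_on_subset)
      show "inj_on (inv \<iota> \<circ> q) {0..1}"
        using q(1) im by (intro comp_inj_on) (auto simp: arc_def path_image_def intro: inj_on_inv_into)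
    qed
    show "path_image (inv \<iota> \<circ> q) \<subseteq> path_image p"
      using q(2) inj by (auto simp: path_image_compose)
  qed (use q inj in \<open>auto simp: pathstart_compose pathfinish_compose\<close>)
qed

section \<open>Arcs and branches in metric trees\<close>

lemma arc_reparametrize_segment:
  fixes g :: "real \<Rightarrow> 'a::topological_space"
  assumes "arc g" "a \<in> {0..1}" "b \<in> {0..1}" "a \<noteq> b"
  shows "arc (g \<circ> linepath a b)" "path_image (g \<circ> linepath a b) = g ` closed_segment a b"
    "pathstart (g \<circ> linepath a b) = g a" "pathfinish (g \<circ> linepath a b) = g b"
proof -
  have sub: "closed_segment a b \<subseteq> {0..1}" using assms by (auto simp: closed_segment_eq_real_ivl)
  show "arc (g \<circ> linepath a b)"
    unfolding arc_def
  proof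
    show "path (g \<circ> linepath a b)"
      using assms(1) sub by (intro path_continuous_image) (auto simp: arc_def path_def intro: continuous_on_subset)
    have "inj_on g (linepath a b ` {0..1})"
      using assms(1) sub by (auto simp: arc_def linepath_image_01 intro: inj_on_subset)
    then show "inj_on (g \<circ> linepath a b) {0..1}"
      using assms(4) by (intro comp_inj_on inj_on_linepath)
  qed
  show "path_image (g \<circ> linepath a b) = g ` closed_segment a b"
    by (simp add: path_image_compose)
  show "pathstart (g \<circ> linepath a b) = g a" "pathfinish (g \<circ> linepath a b) = g b"
    by (simp_all add: pathstart_compose pathfinish_compose)
qed

text \<open>If the first arc leaves the second at some time \<open>t\<close>, consider the maximal time interval
  \<open>(a, b)\<close> around \<open>t\<close> during which it is away from it. The excursion over \<open>[a, b]\<close> and the part of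
  the second arc between its two ends form a simple closed curve.\<close>

lemma arc_image_subset_if_no_loop:
  fixes M :: "'a::metric_space set"
  assumes M: "\<nexists>l. simple_path l \<and> pathfinish l = pathstart l \<and> path_image l \<subseteq> M"
    and g: "arc g" "path_image g \<subseteq> M" and h: "arc h" "path_image h \<subseteq> M"
    and ends: "pathstart g = pathstart h" "pathfinish g = pathfinish h"
  shows "path_image g \<subseteq> path_image h"
proof (rule ccontr)
  assume "\<not> ?thesis"
  then obtain t where t: "t \<in> {0..1}" "g t \<notin> path_image h" unfolding path_image_def by blast
  \<comment> \<open>The set of times at which g is on h; a is the last such time before t, and b the first after t.\<close>
  define B where "B = {t \<in> {0..1}. g t \<in> path_image h}"
  have "closed (path_image h)" using h(1) by (simp add: closed_arc_image)
  moreover have "continuous_on {0..1} g" using g(1) by (simp add: arc_def path_def)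
  ultimately have "closed ({0..1} \<inter> g -` path_image h)"
    by (intro continuous_closed_preimage) auto
  moreover have "{0..1} \<inter> g -` path_image h = B" by (auto simp: B_def)
  moreover have "B = {0..1} \<inter> B" by (auto simp: B_def)
  ultimately have B: "compact B" using compact_Int_closed[of "{0..1::real}" B] by simp
  have B01: "0 \<in> B" "1 \<in> B" 
    using ends unfolding B_def pathstart_def pathfinish_def path_image_def by auto
  have tB: "t \<notin> B" using t by (simp add: B_def)
  have "compact (B \<inter> {0..t})" "B \<inter> {0..t} \<noteq> {}"
    using B B01 t by (auto intro: compact_Int)
  from compact_attains_sup[OF this] obtain a where a: "a \<in> B" "a \<in> {0..t}" "\<And>y. y \<in> B \<Longrightarrow> y \<in> {0..t} \<Longrightarrow> y \<le> a" by blast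
  have "compact (B \<inter> {t..1})" "B \<inter> {t..1} \<noteq> {}"
    using B B01 t by (auto intro: compact_Int)
  from compact_attains_inf[OF this] obtain b where b: "b \<in> B" "b \<in> {t..1}" "\<And>y. y \<in> B \<Longrightarrow> y \<in> {t..1} \<Longrightarrow> b \<le> y" by blast
  have ab: "a < t" "t < b" using a b tB by (auto simp: order.order_iff_strict)
  have gap: "y \<notin> B" if "a < y" "y < b" for y
    using a(3)[of y] b(3)[of y] that ab a b t by (cases "y \<le> t") force+
  obtain u where u: "u \<in> {0..1}" "h u = g a" using a(1) unfolding B_def path_image_def by force
  obtain v where v: "v \<in> {0..1}" "h v = g b" using b(1) unfolding B_def path_image_def by force
  have a01: "a \<in> {0..1}" "b \<in> {0..1}" using a b by (auto simp: B_def)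
  have "g a \<noteq> g b" using g(1) ab a01 by (auto simp: arc_def dest: inj_onD)
  then have uv: "u \<noteq> v" using u v by auto
  define ga where "ga = g \<circ> linepath a b"
  define hv where "hv = h \<circ> linepath v u"
  note ga = arc_reparametrize_segment[OF g(1) a01, folded ga_def]
  note hv = arc_reparametrize_segment[OF h(1) v(1) u(1) uv[symmetric], folded hv_def]
  define l where "l = ga +++ hv"
  have neq: "a \<noteq> b" using ab by simp
  note ga = ga[OF neq]
  have ga_sub: "path_image ga \<subseteq> path_image g"
    unfolding ga(2) path_image_def[of g] using a01 by (intro image_mono) (auto simp: closed_segment_eq_real_ivl)
  have hv_sub: "path_image hv \<subseteq> path_image h"
    unfolding hv(2) path_image_def[of h] using u v by (intro image_mono) (auto simp: closed_segment_eq_real_ivl)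
  have "path_image ga \<inter> path_image hv \<subseteq> {g a, g b}"
  proof
    fix x assume x: "x \<in> path_image ga \<inter> path_image hv"
    then obtain y where y: "y \<in> {a..b}" "x = g y" using ab by (auto simp: ga(2) closed_segment_eq_real_ivl)
    have "y \<in> B" using x hv_sub y a01 by (auto simp: B_def)
    then have "y = a \<or> y = b" using gap[of y] y by (metis atLeastAtMost_iff less_le)
    then show "x \<in> {g a, g b}" using y by auto
  qed
  then have "simple_path l" unfolding l_def
    by (intro simple_path_join_loop ga(1) hv(1)) (use u v ga hv in auto)
  moreover have "pathfinish l = pathstart l" by (simp add: l_def u ga hv)
  moreover have "path_image l \<subseteq> M"
    unfolding l_def using path_image_join_subset[of ga hv] ga_sub hv_sub g(2) h(2) by blast
  ultimately show False using M by blast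
qed

lemma metric_tree_arc_image_unique:
  assumes "metric_tree M" "arc g" "path_image g \<subseteq> M" "arc h" "path_image h \<subseteq> M"
    "pathstart g = pathstart h" "pathfinish g = pathfinish h"
  shows "path_image g = path_image h"
  using assms unfolding metric_tree_def
  by (intro equalityI arc_image_subset_if_no_loop[of M]) auto

text \<open>If the two ends were in the same branch at \<open>z\<close>, an arc avoiding \<open>z\<close> would join them. But the
  two given arcs together form an arc through \<open>z\<close> with the same ends, contradicting uniqueness.\<close>

lemma arcs_in_different_branches:
  fixes M :: "'a::metric_space set"
  assumes M: "metric_tree M"
    and g: "arc g" "path_image g \<subseteq> M" "pathstart g = z"
    and h: "arc h" "path_image h \<subseteq> M" "pathstart h = z"
    and gh: "path_image g \<inter> path_image h = {z}"
  shows "\<not> connected_component (M - {z}) (pathfinish g) (pathfinish h)"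
proof
  assume cc: "connected_component (M - {z}) (pathfinish g) (pathfinish h)"
  define C where "C = connected_component_set (M - {z}) (pathfinish g)"
  have MM: "compact M" "locally connected M" using M by (auto simp: metric_tree_def)
  have op: "openin (top_of_set M) (M - {z})"
    unfolding openin_open by (intro exI[of _ "- {z}"]) auto
  then have "locally connected (M - {z})" by (rule locally_open_subset[OF MM(2)])
  then have "openin (top_of_set (M - {z})) C" unfolding C_def by (rule openin_connected_component_locally_connected)
  then have "openin (top_of_set M) C" using op openin_trans by blast
  moreover have "connected C" unfolding C_def by simp
  moreover have "pathfinish g \<in> C" "pathfinish h \<in> C"
    using cc connected_component_in[OF cc] unfolding C_def by (auto simp: connected_component_refl)
  ultimately obtain p where p: "path p" "path_image p \<subseteq> C" "pathstart p = pathfinish g" "pathfinish p = pathfinish h"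
    using openin_connected_imp_path_connected[OF MM] by blast
  have C: "C \<subseteq> M - {z}" unfolding C_def by (rule connected_component_subset)
  have arc: "arc (reversepath g +++ h)"
    using g h gh by (intro arc_join) (auto simp: arc_reversepath)
  then have "pathfinish g \<noteq> pathfinish h" using arc_distinct_ends by fastforce
  then obtain q where q: "arc q" "path_image q \<subseteq> path_image p" "pathstart q = pathfinish g" "pathfinish q = pathfinish h"
    using path_contains_arc_metric[OF p(1,3,4)] by blast
  have "path_image (reversepath g +++ h) = path_image q"
  proof (rule metric_tree_arc_image_unique[OF M arc])
    show "path_image (reversepath g +++ h) \<subseteq> M"
      using path_image_join_subset[of "reversepath g" h] g h by auto
  qed (use q p C in auto)
  moreover have "z \<in> path_image (reversepath g +++ h)"
    using g h by (subst path_image_join) (auto simp: pathstart_in_path_image)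
  ultimately show False using q p C by blast
qed

section \<open>Heights of branch points\<close>

lemma ex_branch_numbering:
  assumes fin: "finite (branches T p)"
  shows "\<exists>B. branch_numbering T p B"
proof -
  obtain xs where xs: "set xs = branches T p" "distinct xs" using finite_distinct_list[OF fin] by blast
  define ys where "ys = rev (sort_key diameter xs)"
  have ys: "set ys = branches T p" "distinct ys" using xs by (auto simp: ys_def)
  have val: "valence T p = enat (length ys)"
    using fin ys by (simp add: valence_def distinct_card[symmetric])
  have sorted: "sorted (map diameter (rev ys))" by (simp add: ys_def)
  have "diameter (ys ! j) \<le> diameter (ys ! i)" if "i \<le> j" "j < length ys" for i j
    using sorted_rev_nth_mono[of "map diameter ys" i j] sorted that by (simp add: rev_map)
  moreover have "bij_betw (\<lambda>i. ys ! (i - 1)) {i. 1 \<le> i \<and> enat i \<le> valence T p} (branches T p)"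
  proof -
    have "bij_betw (\<lambda>i. i - 1) {i. 1 \<le> i \<and> i \<le> length ys} {..<length ys}"
      by (rule bij_betw_byWitness[where f' = Suc]) auto
    moreover have "bij_betw ((!) ys) {..<length ys} (branches T p)"
      using bij_betw_nth[OF ys(2)] ys(1) by blast
    ultimately have "bij_betw ((!) ys \<circ> (\<lambda>i. i - 1)) {i. 1 \<le> i \<and> i \<le> length ys} (branches T p)"
      by (rule bij_betw_trans)
    then show ?thesis by (simp add: val o_def)
  qed
  ultimately show ?thesis unfolding branch_numbering_def
    by (intro exI[of _ "\<lambda>i. ys ! (i - 1)"]) (auto simp: val)
qed

lemma branch_numbering_branch:
  "finite (branches T p) \<Longrightarrow> branch_numbering T p (branch T p)"
  unfolding branch_def by (rule someI_ex[of "branch_numbering T p"]) (rule ex_branch_numbering)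

lemma branch_index:
  assumes fin: "finite (branches T p)" and D: "D \<in> branches T p"
  obtains i where "1 \<le> i" "i \<le> card (branches T p)" "branch T p i = D"
proof -
  have val: "valence T p = enat (card (branches T p))" using fin by (simp add: valence_def)
  have "branch T p ` {i. 1 \<le> i \<and> i \<le> card (branches T p)} = branches T p"
    using branch_numbering_branch[OF fin] unfolding branch_numbering_def val
    by (simp add: bij_betw_def)
  then show thesis using D that by (smt (verit) imageE mem_Collect_eq)
qed

lemma diameter_branch_antimono:
  assumes fin: "finite (branches T p)" and ij: "1 \<le> i" "i \<le> j" "j \<le> card (branches T p)"
  shows "diameter (branch T p j) \<le> diameter (branch T p i)"
  using branch_numbering_branch[OF fin] ij fin unfolding branch_numbering_def valence_def
  by simp

lemma branch_height_le:
  assumes card: "card (branches T p) = 3" and D: "D \<in> branches T p"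
  shows "branch_height T p \<le> diameter D"
proof -
  have fin: "finite (branches T p)" using card card.infinite by fastforce
  obtain i where i: "1 \<le> i" "i \<le> 3" "branch T p i = D"
    using branch_index[OF fin D] card by metis
  then show ?thesis
    using diameter_branch_antimono[OF fin, of i 3] card by (simp add: branch_height_def)
qed

text \<open>Three different branches occupy three different numbers, the largest of which is at least 3;
  since diameters do not increase with the number, the third branch is at least as large.\<close>

lemma branch_height_ge:
  assumes fin: "finite (branches T p)"
    and D: "D1 \<in> branches T p" "D2 \<in> branches T p" "D3 \<in> branches T p"
    and dist: "D1 \<noteq> D2" "D2 \<noteq> D3" "D1 \<noteq> D3"
    and h: "h \<le> diameter D1" "h \<le> diameter D2" "h \<le> diameter D3"
  shows "3 \<le> valence T p" "h \<le> branch_height T p"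
proof -
  have val: "valence T p = enat (card (branches T p))" using fin by (simp add: valence_def)
  obtain i where i: "1 \<le> i" "i \<le> card (branches T p)" "branch T p i = D1"
    using branch_index[OF fin D(1)] .
  obtain j where j: "1 \<le> j" "j \<le> card (branches T p)" "branch T p j = D2"
    using branch_index[OF fin D(2)] .
  obtain k where k: "1 \<le> k" "k \<le> card (branches T p)" "branch T p k = D3"
    using branch_index[OF fin D(3)] .
  define m where "m = max i (max j k)"
  have "i \<noteq> j" "j \<noteq> k" "i \<noteq> k" using i j k dist by auto
  then have m: "3 \<le> m" "m \<le> card (branches T p)" using i j k by (auto simp: m_def)
  have hm: "h \<le> diameter (branch T p m)" using i j k h by (auto simp: m_def max_def)
  show "3 \<le> valence T p" unfolding val using m by (simp add: numeral_eq_enat)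
  have "diameter (branch T p m) \<le> diameter (branch T p 3)"
    using diameter_branch_antimono[OF fin, of 3 m] m by simp
  then show "h \<le> branch_height T p" using hm by (simp add: branch_height_def)
qed

text \<open>The arc without its starting point \<open>z\<close> lies in the branch, and its points tend to \<open>z\<close>.\<close>

lemma diameter_branch_ge:
  assumes M: "bounded M" and D: "D \<in> branches M z"
    and g: "path g" "path_image g \<subseteq> M" "pathstart g = z" "pathfinish g \<in> D" "inj_on g {0..1}"
  shows "dist z (pathfinish g) \<le> diameter D"
proof -
  have DM: "D \<subseteq> M - {z}" using D in_components_subset by blast
  then have bd: "bounded D" using M bounded_subset by blast
  have "g ` {0<..1} \<subseteq> D"
  proof (rule components_maximal[OF D])
    show "connected (g ` {0<..1})"
      using g(1) by (intro connected_continuous_image) (auto simp: path_def intro: continuous_on_subset)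
    have "g x \<noteq> z" if "x \<in> {0<..1}" for x
      using inj_onD[OF g(5), of x 0] that g(3) by (auto simp: pathstart_def)
    then show "g ` {0<..1} \<subseteq> M - {z}" using g(2) unfolding path_image_def by force
    show "D \<inter> g ` {0<..1} \<noteq> {}" using g(4) unfolding pathfinish_def by force
  qed
  then have sub: "g x \<in> D" if "x \<in> {0<..1}" for x using that by blast
  have le: "dist (g x) (g 1) \<le> diameter D" if "x \<in> {0<..1}" for x
    using diameter_bounded_bound[OF bd sub[OF that] sub[of 1]] by simp
  have "continuous_on {0..1} (\<lambda>x. dist (g x) (g 1))"
    using g(1) by (auto simp: path_def intro!: continuous_intros)
  then have "((\<lambda>x. dist (g x) (g 1)) \<longlongrightarrow> dist (g 0) (g 1)) (at 0 within {0..1})"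
    by (auto simp: continuous_on_def)
  moreover have "eventually (\<lambda>x. dist (g x) (g 1) \<le> diameter D) (at 0 within {0..1})"
    unfolding eventually_at using le by (intro exI[of _ 1]) auto
  moreover have "at (0::real) within {0..1} \<noteq> bot"
    by (simp add: at_within_Icc_at_right)
  ultimately have "dist (g 0) (g 1) \<le> diameter D" by (intro tendsto_upperbound) auto
  then show ?thesis using g by (simp add: pathstart_def pathfinish_def)
qed

text \<open>This is how branch points are recognized in an abstract tree: three arcs that leave \<open>z\<close> and
  meet nowhere else end in three different branches.\<close>

lemma tripod_branch_height:
  fixes M :: "'a::metric_space set"
  assumes M: "metric_tree M" and fin: "finite (branches M z)"
    and g: "\<And>i. i \<in> {0,1,2::nat} \<Longrightarrow> arc (g i) \<and> path_image (g i) \<subseteq> M \<and> pathstart (g i) = z \<and> h \<le> dist z (pathfinish (g i))"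
    and gg: "\<And>i j. \<lbrakk>i \<in> {0,1,2}; j \<in> {0,1,2}; i < j\<rbrakk> \<Longrightarrow> path_image (g i) \<inter> path_image (g j) \<subseteq> {z}"
  shows "z \<in> branch_points M" "h \<le> branch_height M z"
proof -
  have bd: "bounded M" using M by (auto simp: metric_tree_def compact_imp_bounded)
  define D where "D i = connected_component_set (M - {z}) (pathfinish (g i))" for i
  have fin1: "pathfinish (g i) \<in> M - {z}" if "i \<in> {0,1,2}" for i
    using g[OF that] arc_distinct_ends[of "g i"] by auto
  have D: "D i \<in> branches M z" if "i \<in> {0,1,2}" for i
    unfolding D_def using fin1[OF that] by (rule componentsI)
  have fD: "pathfinish (g i) \<in> D i" if "i \<in> {0,1,2}" for i
    using fin1[OF that] by (simp add: D_def connected_component_refl)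
  have h: "h \<le> diameter (D i)" if "i \<in> {0,1,2}" for i
    using diameter_branch_ge[OF bd D[OF that], of "g i"] g[OF that] fD[OF that]
    by (auto simp: arc_def)
  have ne: "D i \<noteq> D j" if "i \<in> {0,1,2}" "j \<in> {0,1,2}" "i < j" for i j
  proof
    assume "D i = D j"
    then have "connected_component (M - {z}) (pathfinish (g i)) (pathfinish (g j))"
      using fD[OF that(2)] unfolding D_def by (metis mem_Collect_eq)
    moreover have "z \<in> path_image (g i)" "z \<in> path_image (g j)"
      using g[OF that(1)] g[OF that(2)] by (metis pathstart_in_path_image)+
    then have "path_image (g i) \<inter> path_image (g j) = {z}" using gg[OF that] by blast
    ultimately show False
      using arcs_in_different_branches[OF M, of "g i" z "g j"] g[OF that(1)] g[OF that(2)] by blast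
  qed
  have "z \<in> M" using g[of 0] by auto
  then show "z \<in> branch_points M"
    using branch_height_ge(1)[OF fin D[of 0] D[of 1] D[of 2] ne[of 0 1] ne[of 1 2] ne[of 0 2] h[of 0] h[of 1] h[of 2]]
    by (simp add: branch_points_def)
  show "h \<le> branch_height M z"
    using branch_height_ge(2)[OF fin D[of 0] D[of 1] D[of 2] ne[of 0 1] ne[of 1 2] ne[of 0 2] h[of 0] h[of 1] h[of 2]]
    by simp
qed

lemma finite_separated_subset_compact:
  fixes S :: "'a::metric_space set"
  assumes "compact K" "S \<subseteq> K" and d: "0 < d" and sep: "\<And>x y. \<lbrakk>x \<in> S; y \<in> S; x \<noteq> y\<rbrakk> \<Longrightarrow> d \<le> dist x y"
  shows "finite S"
proof -
  have "closed S" using sep d by (intro discrete_imp_closed[of d]) force+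
  then have "compact (K \<inter> S)" using assms(1) by (simp add: compact_Int_closed)
  then have "compact S" using assms(2) by (simp add: Int_absorb1)
  then obtain F where F: "finite F" "F \<subseteq> S" "S \<subseteq> (\<Union>x\<in>F. ball x d)"
    using compactE_image[of S S "\<lambda>x. ball x d"] d by (metis UN_I centre_in_ball open_ball subsetI)
  have "S \<subseteq> F"
  proof
    fix x assume x: "x \<in> S"
    then obtain y where "y \<in> F" "dist y x < d" using F by auto
    then have "y = x" using sep[of y x] x F by force
    then show "x \<in> F" using \<open>y \<in> F\<close> by simp
  qed
  then show ?thesis using F finite_subset by blast
qed

text \<open>By relative separation and compactness there are only finitely many branch points of height at
  least any given positive number.\<close>

lemma countable_branch_points:
  assumes M: "M \<in> geodesic_trees n c" and c: "0 < c"
  shows "countable {p \<in> branch_points M. 0 < branch_height M p}"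
proof -
  have "finite {p \<in> branch_points M. 1 / real (Suc m) \<le> branch_height M p}" for m
  proof (rule finite_separated_subset_compact)
    show "compact M" using M by (simp add: geodesic_trees_def geodesic_tree_def metric_tree_def)
    show "0 < c * (1 / real (Suc m))" using c by simp
    fix x y assume xy: "x \<in> {p \<in> branch_points M. 1 / real (Suc m) \<le> branch_height M p}"
       "y \<in> {p \<in> branch_points M. 1 / real (Suc m) \<le> branch_height M p}" "x \<noteq> y"
    then have "c * min (branch_height M x) (branch_height M y) \<le> dist x y"
      using M by (auto simp: geodesic_trees_def)
    moreover have "c * (1 / real (Suc m)) \<le> c * min (branch_height M x) (branch_height M y)"
      using xy c by (intro mult_left_mono) auto
    ultimately show "c * (1 / real (Suc m)) \<le> dist x y" by linarith
  qed (auto simp: branch_points_def)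
  moreover have "{p \<in> branch_points M. 0 < branch_height M p} =
      (\<Union>m. {p \<in> branch_points M. 1 / real (Suc m) \<le> branch_height M p})"
  proof (intro equalityI subsetI)
    fix p assume p: "p \<in> {p \<in> branch_points M. 0 < branch_height M p}"
    then obtain m where "1 / real (Suc m) < branch_height M p"
      using reals_Archimedean[of "branch_height M p"] by (auto simp: inverse_eq_divide)
    then show "p \<in> (\<Union>m. {p \<in> branch_points M. 1 / real (Suc m) \<le> branch_height M p})"
      using p by (auto intro: less_imp_le)
  qed (auto intro: less_le_trans[rotated])
  ultimately show ?thesis by (simp add: countable_finite)
qed

section \<open>Subtrees of the plane with the river metric\<close>

text \<open>The directions at a point of the river are left, right, up and down, coded 0 to 3; the directions
  at a point off the river are towards the river, coded 0, and away from it, coded 1.\<close>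

definition river_direction :: "river \<Rightarrow> river \<Rightarrow> int" where
  "river_direction z q =
     (if ordinate z = 0 then
        if abscissa q < abscissa z then 0 else if abscissa z < abscissa q then 1
        else if 0 < ordinate q then 2 else 3
      else if abscissa q = abscissa z \<and> \<bar>ordinate z\<bar> < ordinate q * sgn (ordinate z) then 1 else 0)"

text \<open>The unique path from \<open>q\<close> to \<open>q'\<close> passes through \<open>z\<close> exactly if the two points lie in different
  directions at \<open>z\<close>. In this form the tree structure of the river metric becomes an equivalence
  relation, which is all that the remaining arguments use.\<close>

lemma river_direction_eq_iff:
  assumes "q \<noteq> z" "q' \<noteq> z"
  shows "river_direction z q = river_direction z q' \<longleftrightarrow> dist q q' < dist q z + dist z q'"
proof -
  obtain x y where z: "z = River x y" by (cases z)
  obtain u v where q: "q = River u v" by (cases q)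
  obtain u' v' where q': "q' = River u' v'" by (cases q')
  have ne: "u = x \<Longrightarrow> v \<noteq> y" "u' = x \<Longrightarrow> v' \<noteq> y" using assms by (auto simp: z q q')
  consider "y = 0" | "y > 0" | "y < 0" by linarith
  then show ?thesis
  proof cases
    case 1
    show ?thesis
      by (cases u x rule: linorder_cases; cases u' x rule: linorder_cases)
        (use ne 1 in \<open>auto simp: z q q' river_direction_def dist_river_def\<close>)
  next
    case 2
    show ?thesis
      by (cases "u = x"; cases "u' = x"; cases "u = u'")
        (use ne 2 in \<open>auto simp: z q q' river_direction_def dist_river_def\<close>)
  next
    case 3
    show ?thesis
      by (cases "u = x"; cases "u' = x"; cases "u = u'")
        (use ne 3 in \<open>auto simp: z q q' river_direction_def dist_river_def\<close>)
  qed
qed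

lemma river_direction_neq:
  assumes "q \<noteq> z" "q' \<noteq> z" "river_direction z q \<noteq> river_direction z q'"
  shows "dist q q' = dist q z + dist z q'"
  using river_direction_eq_iff[OF assms(1,2)] assms(3) dist_triangle[of q q' z] by force

text \<open>Otherwise \<open>p\<close> and \<open>r'\<close> would lie in the same direction at \<open>r\<close>, which is not the direction of
  \<open>q\<close>; then \<open>r\<close> would lie between \<open>r'\<close> and \<open>q\<close>, so that \<open>r'\<close> would be closer to \<open>p\<close> than \<open>r\<close>.\<close>

lemma between_dist:
  fixes p q r r' :: river
  assumes r: "dist p r + dist r q = dist p q" and r': "dist p r' + dist r' q = dist p q"
    and le: "dist p r \<le> dist p r'"
  shows "dist r r' = dist p r' - dist p r"
proof (cases "r = r' \<or> r = p \<or> r = q")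
  case True
  have "r' = q" if "r = q"
  proof -
    have "dist p q \<le> dist p r'" using le that by simp
    then have "dist r' q \<le> 0" using r' by linarith
    then show ?thesis by simp
  qed
  then show ?thesis using True assms by (auto simp: dist_commute)
next
  case False
  show ?thesis
  proof (rule ccontr)
    assume "\<not> ?thesis"
    then have "dist p r' < dist p r + dist r r'"
      using dist_triangle[of p r' r] by linarith
    then have "river_direction r p = river_direction r r'"
      using river_direction_eq_iff[of p r r'] False by auto
    moreover have "river_direction r p \<noteq> river_direction r q"
      using river_direction_eq_iff[of p r q] False r by auto
    ultimately have "dist r' q = dist r' r + dist r q"
      using river_direction_neq[of r' r q] False by auto
    then have "dist r' r \<le> 0" using r r' le by linarith
    then show False using False by simp
  qed
qed

text \<open>The nonempty combs are the subsets that meet the river and contain, with any two of their points,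
  the path joining them.\<close>

definition comb :: "river set \<Rightarrow> bool" where
  "comb T \<longleftrightarrow> is_interval {x. River x 0 \<in> T} \<and>
     (\<forall>x y y'. River x y \<in> T \<and> y' \<in> closed_segment 0 y \<longrightarrow> River x y' \<in> T)"

lemma combD:
  assumes "comb T"
  shows "\<lbrakk>River x 0 \<in> T; River x' 0 \<in> T; x \<le> x''; x'' \<le> x'\<rbrakk> \<Longrightarrow> River x'' 0 \<in> T"
    and "\<lbrakk>River x y \<in> T; 0 \<le> y'; y' \<le> y\<rbrakk> \<Longrightarrow> River x y' \<in> T"
    and "\<lbrakk>River x y \<in> T; y \<le> y'; y' \<le> 0\<rbrakk> \<Longrightarrow> River x y' \<in> T"
    and "River x y \<in> T \<Longrightarrow> River x 0 \<in> T"
proof -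
  have I: "is_interval {x. River x 0 \<in> T}" and V: "\<And>x y y'. River x y \<in> T \<Longrightarrow> y' \<in> closed_segment 0 y \<Longrightarrow> River x y' \<in> T"
    using assms unfolding comb_def by blast+
  show "\<lbrakk>River x 0 \<in> T; River x' 0 \<in> T; x \<le> x''; x'' \<le> x'\<rbrakk> \<Longrightarrow> River x'' 0 \<in> T"
    using I unfolding is_interval_1 by blast
  show "\<lbrakk>River x y \<in> T; 0 \<le> y'; y' \<le> y\<rbrakk> \<Longrightarrow> River x y' \<in> T"
    by (rule V) (auto simp: closed_segment_eq_real_ivl)
  show "\<lbrakk>River x y \<in> T; y \<le> y'; y' \<le> 0\<rbrakk> \<Longrightarrow> River x y' \<in> T"
    by (rule V) (auto simp: closed_segment_eq_real_ivl)
  show "River x y \<in> T \<Longrightarrow> River x 0 \<in> T" by (rule V) auto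
qed

text \<open>The point at distance \<open>s\<close> from \<open>p\<close> on the path to \<open>q\<close> is found by walking: vertically to the
  river, along the river, and vertically to \<open>q\<close>.\<close>

lemma comb_point_at_distance:
  assumes T: "comb T" and pq: "p \<in> T" "q \<in> T" and s: "0 \<le> s" "s \<le> dist p q"
  shows "\<exists>r\<in>T. dist p r = s \<and> dist r q = dist p q - s"
proof -
  obtain x y where p: "p = River x y" by (cases p)
  obtain x' y' where q: "q = River x' y'" by (cases q)
  note T1 = combD(1)[OF T] and T2 = combD(2)[OF T] and T3 = combD(3)[OF T]
  have 0: "River x 0 \<in> T" "River x' 0 \<in> T" using pq combD(4)[OF T] by (auto simp: p q)
  show ?thesis
  proof (cases "x = x'")
    case True
    define w where "w = (if y \<le> y' then y + s else y - s)"
    have w: "w \<in> {y..y'} \<or> w \<in> {y'..y}" using s by (auto simp: w_def p q True dist_river_def)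
    have "River x w \<in> T"
    proof (cases "0 \<le> w")
      case nonneg: True
      then show ?thesis using w T2[of x y w] T2[of x y' w] pq by (auto simp: p q True)
    next
      case False
      then show ?thesis using w T3[of x y w] T3[of x y' w] pq by (auto simp: p q True)
    qed
    moreover have "dist p (River x w) = s" "dist (River x w) q = dist p q - s"
      using s by (auto simp: w_def p q True dist_river_def split: if_splits)
    ultimately show ?thesis by blast
  next
    case False
    have d: "dist p q = \<bar>y\<bar> + \<bar>x - x'\<bar> + \<bar>y'\<bar>" using False by (simp add: p q dist_river_def)
    consider "s < \<bar>y\<bar>" | "\<bar>y\<bar> \<le> s" "s < \<bar>y\<bar> + \<bar>x - x'\<bar>" | "\<bar>y\<bar> + \<bar>x - x'\<bar> \<le> s" by linarith
    then show ?thesis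
    proof cases
      case 1
      define w where "w = (if 0 \<le> y then y - s else y + s)"
      have "River x w \<in> T"
        using T2[of x y w] T3[of x y w] pq 1 s by (auto simp: w_def p split: if_splits)
      moreover have "dist p (River x w) = s" "dist (River x w) q = dist p q - s"
        using 1 s False d by (auto simp: w_def p q dist_river_def split: if_splits)
      ultimately show ?thesis by blast
    next
      case 2
      define w where "w = (if x \<le> x' then x + (s - \<bar>y\<bar>) else x - (s - \<bar>y\<bar>))"
      have "River w 0 \<in> T"
        using T1[of x x' w] T1[of x' x w] 0 2 by (auto simp: w_def split: if_splits)
      moreover have "dist p (River w 0) = s" "dist (River w 0) q = dist p q - s"
        using 2 s False d by (auto simp: w_def p q dist_river_def split: if_splits)
      ultimately show ?thesis by blast
    next
      case 3
      define w where "w = (if 0 \<le> y' then s - \<bar>y\<bar> - \<bar>x - x'\<bar> else - (s - \<bar>y\<bar> - \<bar>x - x'\<bar>))"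
      have "River x' w \<in> T"
        using T2[of x' y' w] T3[of x' y' w] pq 3 s d by (auto simp: w_def q split: if_splits)
      moreover have "dist p (River x' w) = s" "dist (River x' w) q = dist p q - s"
        using 3 s False d by (auto simp: w_def p q dist_river_def split: if_splits)
      ultimately show ?thesis by blast
    qed
  qed
qed

lemma comb_geodesic:
  assumes T: "comb T" and pq: "p \<in> T" "q \<in> T"
  obtains \<gamma> where "\<gamma> ` {0..dist p q} \<subseteq> T"
    "\<And>s. s \<in> {0..dist p q} \<Longrightarrow> dist p (\<gamma> s) = s \<and> dist (\<gamma> s) q = dist p q - s"
    "\<And>s t. s \<in> {0..dist p q} \<Longrightarrow> t \<in> {0..dist p q} \<Longrightarrow> dist (\<gamma> s) (\<gamma> t) = \<bar>s - t\<bar>"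
    "\<gamma> 0 = p" "\<gamma> (dist p q) = q"
proof -
  have "\<forall>s\<in>{0..dist p q}. \<exists>r. r \<in> T \<and> dist p r = s \<and> dist r q = dist p q - s"
    using comb_point_at_distance[OF T pq] by (auto simp: Bex_def)
  then obtain \<gamma> where \<gamma>: "\<And>s. s \<in> {0..dist p q} \<Longrightarrow> \<gamma> s \<in> T \<and> dist p (\<gamma> s) = s \<and> dist (\<gamma> s) q = dist p q - s"
    by metis
  show thesis
  proof (rule that)
    have *: "dist (\<gamma> s) (\<gamma> t) = t - s" if "s \<in> {0..dist p q}" "t \<in> {0..dist p q}" "s \<le> t" for s t
      using between_dist[of p "\<gamma> s" q "\<gamma> t"] \<gamma>[OF that(1)] \<gamma>[OF that(2)] that(3) by simp
    show "dist (\<gamma> s) (\<gamma> t) = \<bar>s - t\<bar>" if "s \<in> {0..dist p q}" "t \<in> {0..dist p q}" for s t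
      using *[OF that] *[OF that(2,1)] by (cases "s \<le> t") (auto simp: dist_commute)
    show "\<gamma> 0 = p" using \<gamma>[of 0] by simp
    show "\<gamma> (dist p q) = q" using \<gamma>[of "dist p q"] by simp
  qed (use \<gamma> in auto)
qed

lemma comb_geodesic_connected:
  assumes T: "comb T" and pq: "p \<in> T" "q \<in> T"
  obtains S where "connected S" "S \<subseteq> T" "p \<in> S" "q \<in> S" "\<And>r. r \<in> S \<Longrightarrow> dist p r + dist r q = dist p q"
proof -
  obtain \<gamma> where \<gamma>: "\<gamma> ` {0..dist p q} \<subseteq> T"
    "\<And>s. s \<in> {0..dist p q} \<Longrightarrow> dist p (\<gamma> s) = s \<and> dist (\<gamma> s) q = dist p q - s"
    "\<And>s t. s \<in> {0..dist p q} \<Longrightarrow> t \<in> {0..dist p q} \<Longrightarrow> dist (\<gamma> s) (\<gamma> t) = \<bar>s - t\<bar>"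
    "\<gamma> 0 = p" "\<gamma> (dist p q) = q"
    using comb_geodesic[OF assms] by blast
  have "continuous_on {0..dist p q} \<gamma>"
    unfolding continuous_on_iff using \<gamma>(3) by (metis dist_real_def)
  then have "connected (\<gamma> ` {0..dist p q})" by (intro connected_continuous_image) auto
  moreover have "p \<in> \<gamma> ` {0..dist p q}" using \<gamma>(4) by force
  moreover have "q \<in> \<gamma> ` {0..dist p q}" using \<gamma>(5) by (metis image_eqI atLeastAtMost_iff order_refl zero_le_dist)
  moreover have "dist p r + dist r q = dist p q" if "r \<in> \<gamma> ` {0..dist p q}" for r
  proof -
    obtain s where "s \<in> {0..dist p q}" "r = \<gamma> s" using \<open>r \<in> \<gamma> ` {0..dist p q}\<close> by blast
    then show ?thesis using \<gamma>(2)[of s] by simp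
  qed
  ultimately show thesis using \<gamma>(1) that by blast
qed

text \<open>Points in the same direction are joined by a geodesic that avoids \<open>z\<close>. Conversely the direction
  is locally constant away from \<open>z\<close>, hence constant on connected sets.\<close>

lemma comb_same_branch_iff:
  assumes T: "comb T" and pq: "p \<in> T - {z}" "q \<in> T - {z}"
  shows "connected_component (T - {z}) p q \<longleftrightarrow> river_direction z p = river_direction z q"
proof
  assume eq: "river_direction z p = river_direction z q"
  obtain S where S: "connected S" "S \<subseteq> T" "p \<in> S" "q \<in> S" "\<And>r. r \<in> S \<Longrightarrow> dist p r + dist r q = dist p q"
    using comb_geodesic_connected[OF T, of p q] pq by blast
  have "z \<notin> S" using S(5)[of z] eq river_direction_eq_iff[of p z q] pq by auto
  then show "connected_component (T - {z}) p q" using S unfolding connected_component_def by blast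
next
  assume "connected_component (T - {z}) p q"
  then obtain S where S: "connected S" "S \<subseteq> T - {z}" "p \<in> S" "q \<in> S"
    unfolding connected_component_def by blast
  have nbhd: "river_direction z r' = river_direction z r" if "r \<in> S" "r' \<in> S" "dist r' r < dist r z" for r r'
  proof -
    have "r \<noteq> z" "r' \<noteq> z" using that S by auto
    moreover have "dist r' r < dist r' z + dist z r" using that by (simp add: dist_commute add_strict_increasing2)
    ultimately show ?thesis using river_direction_eq_iff[of r' z r] by simp
  qed
  show "river_direction z p = river_direction z q"
  proof (rule connected_equivalence_relation[OF S(1,3,4), where R = "\<lambda>r r'. river_direction z r = river_direction z r'"])
    fix r assume r: "r \<in> S"
    then have "\<forall>r'\<in>S \<inter> ball r (dist r z). river_direction z r = river_direction z r'"
      using nbhd[OF r] by (metis IntE dist_commute mem_ball)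
    moreover have "0 < dist r z" using r S(2) by auto
    ultimately show "\<exists>T. openin (top_of_set S) T \<and> r \<in> T \<and> (\<forall>r'\<in>T. river_direction z r = river_direction z r')"
      using r by (intro exI[of _ "S \<inter> ball r (dist r z)"]) auto
  qed auto
qed

lemma comb_card_branches:
  assumes T: "comb T"
  shows "finite (branches T z)" "card (branches T z) = card (river_direction z ` (T - {z}))"
proof -
  define \<phi> where "\<phi> D = river_direction z (SOME q. q \<in> D)" for D
  have mem: "(SOME q. q \<in> D) \<in> D" "(SOME q. q \<in> D) \<in> T - {z}" if "D \<in> branches T z" for D
  proof -
    have "D \<noteq> {}" using in_components_nonempty that by blast
    then show "(SOME q. q \<in> D) \<in> D" by (simp add: some_in_eq)
    then show "(SOME q. q \<in> D) \<in> T - {z}" using in_components_subset[OF that] by blast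
  qed
  have comp: "D = connected_component_set (T - {z}) (SOME q. q \<in> D)" if "D \<in> branches T z" for D
    using mem[OF that] that by (metis components_iff connected_component_eq)
  have inj: "inj_on \<phi> (branches T z)"
  proof (rule inj_onI)
    fix D E assume D: "D \<in> branches T z" and E: "E \<in> branches T z" and eq: "\<phi> D = \<phi> E"
    have "connected_component (T - {z}) (SOME q. q \<in> D) (SOME q. q \<in> E)"
      using comb_same_branch_iff[OF T mem(2)[OF D] mem(2)[OF E]] eq by (simp add: \<phi>_def)
    then show "D = E" using comp[OF D] comp[OF E] by (metis connected_component_eq mem_Collect_eq)
  qed
  have im: "\<phi> ` branches T z = river_direction z ` (T - {z})"
  proof (intro equalityI subsetI)
    fix d assume "d \<in> \<phi> ` branches T z"
    then show "d \<in> river_direction z ` (T - {z})" using mem(2) by (auto simp: \<phi>_def)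
  next
    fix d assume "d \<in> river_direction z ` (T - {z})"
    then obtain q where q: "q \<in> T - {z}" "d = river_direction z q" by blast
    define D where "D = connected_component_set (T - {z}) q"
    have D: "D \<in> branches T z" using q unfolding D_def by (intro componentsI)
    have "connected_component (T - {z}) q (SOME q. q \<in> D)" using mem(1)[OF D] by (simp add: D_def)
    then have "river_direction z q = \<phi> D"
      using comb_same_branch_iff[OF T q(1) mem(2)[OF D]] by (simp add: \<phi>_def)
    then show "d \<in> \<phi> ` branches T z" using q D by blast
  qed
  have "river_direction z ` (T - {z}) \<subseteq> {0,1,2,3}" by (auto simp: river_direction_def)
  then have "finite (\<phi> ` branches T z)" unfolding im by (rule finite_subset) simp
  then show "finite (branches T z)" using inj by (rule finite_imageD)
  show "card (branches T z) = card (river_direction z ` (T - {z}))"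
    using card_image[OF inj] im by simp
qed

lemma connected_simple_loop_minus_point:
  fixes g :: "real \<Rightarrow> 'a::topological_space"
  assumes g: "simple_path g" "pathfinish g = pathstart g" and t: "0 < t" "t < 1"
  shows "connected (path_image g - {g t})"
proof -
  have cont: "continuous_on S g" if "S \<subseteq> {0..1}" for S
    using g(1) that by (auto simp: simple_path_def path_def intro: continuous_on_subset)
  have "connected (g ` {0..<t})" "connected (g ` {t<..1})"
    by (intro connected_continuous_image cont; use t in auto)+
  moreover have "g 0 \<in> g ` {0..<t}" "g 0 \<in> g ` {t<..1}"
    using t g(2) by (auto simp: pathstart_def pathfinish_def intro: image_eqI[of _ _ 1])
  ultimately have "connected (g ` {0..<t} \<union> g ` {t<..1})" by (intro connected_Un) auto
  moreover have "path_image g - {g t} = g ` {0..<t} \<union> g ` {t<..1}"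
  proof -
    have eqD: "s = t" if "s \<in> {0..1}" "g s = g t" for s
      using g(1)[unfolded simple_path_def loop_free_def] that t by force
    have inj: "g s \<noteq> g t" if "s \<in> {0..1} - {t}" for s
      using eqD that by blast
    have "path_image g - {g t} = g ` ({0..1} - {t})"
    proof (intro equalityI subsetI)
      fix x assume "x \<in> path_image g - {g t}"
      then obtain s where "s \<in> {0..1}" "x = g s" "s \<noteq> t" unfolding path_image_def by blast
      then show "x \<in> g ` ({0..1} - {t})" by blast
    next
      fix x assume "x \<in> g ` ({0..1} - {t})"
      then obtain s where "s \<in> {0..1} - {t}" "x = g s" by blast
      then show "x \<in> path_image g - {g t}" using inj by (auto simp: path_image_def)
    qed
    moreover have "{0..1} - {t} = {0..<t} \<union> {t<..1}" using t by auto
    ultimately show ?thesis by (simp add: image_Un)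
  qed
  ultimately show ?thesis by simp
qed

text \<open>A simple closed curve stays connected when one of its points is removed, but a point strictly
  between two of its points separates them in a comb.\<close>

lemma comb_no_loop:
  assumes T: "comb T"
  shows "\<nexists>g. simple_path g \<and> pathfinish g = pathstart g \<and> path_image g \<subseteq> T"
proof
  assume "\<exists>g. simple_path g \<and> pathfinish g = pathstart g \<and> path_image g \<subseteq> T"
  then obtain g where g: "simple_path g" "pathfinish g = pathstart g" "path_image g \<subseteq> T" by blast
  define p q where "p = g 0" and "q = g (1/2)"
  have pq: "p \<in> path_image g" "q \<in> path_image g" by (auto simp: p_def q_def path_image_def)
  have "loop_free g" using g(1) by (simp add: simple_path_def)
  from this[unfolded loop_free_def, rule_format, of 0 "1/2"] have "p \<noteq> q"
    by (auto simp: p_def q_def)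
  then have d: "0 < dist p q" by simp
  obtain z where z: "z \<in> T" "dist p z = dist p q / 2" "dist z q = dist p q - dist p q / 2"
    using comb_point_at_distance[OF T, of p q "dist p q / 2"] pq g by auto
  have zpq: "p \<noteq> z" "q \<noteq> z" using z d by auto
  have con: "connected (path_image g - {z})"
  proof (cases "z \<in> path_image g")
    case True
    then obtain t where t: "t \<in> {0..1}" "z = g t" by (auto simp: path_image_def)
    have "t \<noteq> 0" "t \<noteq> 1" using t zpq g(2) by (auto simp: p_def pathstart_def pathfinish_def)
    then show ?thesis using connected_simple_loop_minus_point[OF g(1,2), of t] t by auto
  next
    case False
    then show ?thesis using g(1) by (simp add: connected_simple_path_image)
  qed
  then have "connected_component (T - {z}) p q"
    unfolding connected_component_def using pq zpq g(3) by (intro exI[of _ "path_image g - {z}"]) auto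
  then have "river_direction z p = river_direction z q"
    using comb_same_branch_iff[OF T, of p z q] pq zpq g(3) by auto
  then show False using river_direction_eq_iff[of p z q] z zpq by auto
qed

text \<open>The geodesic from the centre to a point of the ball stays in the ball.\<close>

lemma comb_ball_connected:
  assumes T: "comb T"
    and x: "x \<in> T"
  shows "connected (T \<inter> ball x e)"
proof -
  have *: "connected_component (T \<inter> ball x e) x y" if y: "y \<in> T \<inter> ball x e" for y
  proof -
    obtain S where S: "connected S" "S \<subseteq> T" "x \<in> S" "y \<in> S" "\<And>r. r \<in> S \<Longrightarrow> dist x r + dist r y = dist x y"
      using comb_geodesic_connected[OF T, of x y] x y by blast
    have "dist x r < e" if "r \<in> S" for r
      using S(5)[OF that] y zero_le_dist[of r y] by (simp del: zero_le_dist)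
    then show ?thesis using S unfolding connected_component_def by (intro exI[of _ S]) auto
  qed
  show ?thesis unfolding connected_iff_connected_component
    using * by (meson connected_component_sym connected_component_trans)
qed

lemma comb_locally_connected:
  assumes T: "comb T"
  shows "locally connected T"
proof (rule locallyI)
  fix w x assume w: "openin (top_of_set T) w" and x: "x \<in> w"
  obtain e where e: "0 < e" "ball x e \<inter> T \<subseteq> w"
    using w x unfolding openin_contains_ball by blast
  have xT: "x \<in> T" using w x openin_imp_subset by blast
  have "connected (T \<inter> ball x e)" by (rule comb_ball_connected[OF T xT])
  show "\<exists>u v. openin (top_of_set T) u \<and> connected v \<and> x \<in> u \<and> u \<subseteq> v \<and> v \<subseteq> w"
    using e xT \<open>connected (T \<inter> ball x e)\<close>
    by (intro exI[of _ "T \<inter> ball x e"]) auto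
qed

lemma comb_connected:
  assumes T: "comb T"
  shows "connected T"
  unfolding connected_iff_connected_component
proof (intro ballI)
  fix p q assume "p \<in> T" "q \<in> T"
  then obtain S where "connected S" "S \<subseteq> T" "p \<in> S" "q \<in> S"
    using comb_geodesic_connected[OF T, of p q] by metis
  then show "connected_component T p q" unfolding connected_component_def by blast
qed

lemma comb_metric_tree:
  assumes T: "comb T" "compact T"
  shows "metric_tree T"
  using T comb_connected comb_locally_connected comb_no_loop unfolding metric_tree_def by blast

text \<open>An arc has the same image as the geodesic with the same ends.\<close>

lemma comb_geodesic_tree:
  assumes T: "comb T" "compact T"
  shows "geodesic_tree T"
  unfolding geodesic_tree_def
proof (intro conjI allI impI comb_metric_tree[OF T])
  fix g assume g: "arc g \<and> path_image g \<subseteq> T"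
  define p q where "p = pathstart g" and "q = pathfinish g"
  define D where "D = dist p q"
  have pq: "p \<in> T" "q \<in> T" using g unfolding p_def q_def by auto
  have "p \<noteq> q" using g arc_distinct_ends unfolding p_def q_def by metis
  then have D: "0 < D" by (simp add: D_def)
  obtain \<gamma> where \<gamma>: "\<gamma> ` {0..D} \<subseteq> T"
    "\<And>s t. s \<in> {0..D} \<Longrightarrow> t \<in> {0..D} \<Longrightarrow> dist (\<gamma> s) (\<gamma> t) = \<bar>s - t\<bar>"
    "\<gamma> 0 = p" "\<gamma> D = q"
    using comb_geodesic[OF T(1) pq] unfolding D_def by metis
  define h where "h t = \<gamma> (D * t)" for t
  have mult: "(*) D ` {0..1} = {0..D}" using D by (simp add: image_mult_atLeastAtMost)
  have rng: "D * t \<in> {0..D}" if "t \<in> {0..1}" for t using mult that by blast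
  have dh: "dist (h s) (h t) = D * \<bar>s - t\<bar>" if "s \<in> {0..1}" "t \<in> {0..1}" for s t
    using \<gamma>(2)[OF rng rng, OF that] D unfolding h_def by (simp add: right_diff_distrib[symmetric] abs_mult)
  have "D-lipschitz_on {0..1} h"
    using dh D by (intro lipschitz_onI) (auto simp: dist_real_def)
  then have "path h" unfolding path_def by (rule lipschitz_on_continuous_on)
  moreover have "inj_on h {0..1}"
  proof (rule inj_onI)
    fix s t :: real assume "s \<in> {0..1}" "t \<in> {0..1}" "h s = h t"
    then show "s = t" using dh[of s t] D by simp
  qed
  ultimately have h: "arc h" by (simp add: arc_def)
  have imh: "path_image h = \<gamma> ` {0..D}"
    unfolding path_image_def h_def mult[symmetric] by (simp add: image_image)
  have ends: "pathstart h = p" "pathfinish h = q"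
    using \<gamma>(3,4) by (auto simp: pathstart_def pathfinish_def h_def)
  have "path_image g = path_image h"
    using metric_tree_arc_image_unique[OF comb_metric_tree[OF T], of g h] g h imh \<gamma>(1) ends
    by (simp add: p_def q_def)
  then have im: "path_image g = \<gamma> ` {0..D}" using imh by simp
  have iso: "dist p (\<gamma> s) = s" if "s \<in> {0..D}" for s
    using \<gamma>(2)[of 0 s] \<gamma>(3) that D by simp
  have "isometric (path_image g) {0..D}"
    unfolding isometric_def im
  proof (intro exI[of _ "dist p"] conjI ballI)
    show "dist p ` \<gamma> ` {0..D} = {0..D}" using iso by (force simp: image_image)
    fix x y assume "x \<in> \<gamma> ` {0..D}" "y \<in> \<gamma> ` {0..D}"
    then obtain s t where "s \<in> {0..D}" "x = \<gamma> s" "t \<in> {0..D}" "y = \<gamma> t" by blast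
    then show "dist (dist p x) (dist p y) = dist x y"
      using iso \<gamma>(2) by (simp add: dist_real_def)
  qed
  then show "isometric (path_image g) {0..dist (pathstart g) (pathfinish g)}"
    by (simp add: D_def p_def q_def)
qed

section \<open>The trees belong to the class\<close>

text \<open>In the application the core is the river segment: all but finitely many of the attached segments
  stay within a given distance of it.\<close>

lemma compact_if_compact_core:
  fixes S :: "'a::metric_space set"
  assumes R: "compact R" "R \<subseteq> S"
    and K: "\<And>e. 0 < e \<Longrightarrow> \<exists>K. compact K \<and> K \<subseteq> S \<and> (\<forall>x\<in>S - K. \<exists>y\<in>R. dist x y < e)"
  shows "compact S"
proof (rule compactI)
  fix C assume C: "\<forall>t\<in>C. open t" "S \<subseteq> \<Union>C"
  obtain e where e: "0 < e" "\<And>x. x \<in> R \<Longrightarrow> \<exists>G\<in>C. ball x e \<subseteq> G"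
  proof (rule Heine_Borel_lemma[OF R(1)])
    show "R \<subseteq> \<Union>C" using R C by blast
  qed (use C in blast)+
  obtain F where F: "F \<subseteq> R" "finite F" "R \<subseteq> (\<Union>x\<in>F. ball x (e/2))"
    using compactE_image[OF R(1), of R "\<lambda>x. ball x (e/2)"] e(1)
    by (metis UN_I centre_in_ball half_gt_zero open_ball subsetI)
  have "\<exists>G\<in>C. ball x e \<subseteq> G" if "x \<in> F" for x using that F(1) e(2) by blast
  then obtain G where G: "\<And>x. x \<in> F \<Longrightarrow> G x \<in> C" "\<And>x. x \<in> F \<Longrightarrow> ball x e \<subseteq> G x" by metis
  obtain K where K: "compact K" "K \<subseteq> S" "\<And>x. x \<in> S - K \<Longrightarrow> \<exists>y\<in>R. dist x y < e/2"
    using K[of "e/2"] e(1) by (metis half_gt_zero)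
  have "K \<subseteq> \<Union>C" using K(2) C(2) by blast
  then obtain C1 where C1: "C1 \<subseteq> C" "finite C1" "K \<subseteq> \<Union>C1"
    using compactE[OF K(1)] C(1) by metis
  have "x \<in> \<Union>(C1 \<union> G ` F)" if x: "x \<in> S" for x
  proof (cases "x \<in> K")
    case True
    then show ?thesis using C1(3) by blast
  next
    case False
    then obtain y where y: "y \<in> R" "dist x y < e/2" using K(3) x by blast
    then obtain z where z: "z \<in> F" "dist z y < e/2" using F(3) by auto
    then have "x \<in> ball z e" using dist_triangle2[of z x y] y(2) by simp
    then show ?thesis using G(2)[OF z(1)] z(1) by blast
  qed
  then show "\<exists>C'\<subseteq>C. finite C' \<and> S \<subseteq> \<Union>C'"
    using C1 F(2) G(1) by (intro exI[of _ "C1 \<union> G ` F"]) blast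
qed

definition birth :: "real \<Rightarrow> nat \<Rightarrow> real \<Rightarrow> real \<Rightarrow> bool" where
  "birth a k x e \<longleftrightarrow> (\<exists>l r. (l, r) \<in> distinguished a k \<and> x \<in> {l + a * (r - l), r - a * (r - l)} \<and> e = r - l)"

text \<open>The upward segments of the tree: \<open>h\<close> is the length of the one attached at \<open>x\<close>.\<close>

definition tooth :: "real \<Rightarrow> real \<Rightarrow> real \<Rightarrow> real \<Rightarrow> bool" where
  "tooth a c x h \<longleftrightarrow> x \<in> {0, 1} \<and> h = c \<or> (\<exists>k e. birth a k x e \<and> h = c * a * e)"

lemma subdivision_length:
  fixes a :: real
  assumes "1/4 \<le> a" "a \<le> 1/3" "l < r"
  obtains d where "a * (r - l) = d" "(r - l) / 4 \<le> d" "d \<le> (r - l) / 3"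
proof (rule that[OF refl])
  show "(r - l) / 4 \<le> a * (r - l)" "a * (r - l) \<le> (r - l) / 3"
    using mult_right_mono[of "1/4" a "r - l"] mult_right_mono[of a "1/3" "r - l"] assms by auto
qed

lemma distinguished_bounds:
  assumes a: "1/4 \<le> a" "a \<le> 1/3" and I: "(l, r) \<in> distinguished a k"
  shows "0 \<le> l \<and> l < r \<and> r \<le> 1 \<and> r - l \<le> (1/2) ^ k"
  using I
proof (induction k arbitrary: l r)
  case (Suc k)
  then obtain l0 r0 where I0: "(l0, r0) \<in> distinguished a k"
    and lr: "(l, r) \<in> {(l0, l0 + a * (r0 - l0)), (l0 + a * (r0 - l0), r0 - a * (r0 - l0)), (r0 - a * (r0 - l0), r0)}"
    by auto
  have IH: "0 \<le> l0" "l0 < r0" "r0 \<le> 1" "r0 - l0 \<le> (1/2) ^ k" using Suc.IH[OF I0] by auto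
  obtain d where d: "a * (r0 - l0) = d" "(r0 - l0) / 4 \<le> d" "d \<le> (r0 - l0) / 3"
    using subdivision_length[OF a IH(2)] .
  show ?case using lr IH d(2,3) unfolding d(1) by auto
qed auto

lemma distinguished_nonoverlapping:
  assumes a: "1/4 \<le> a" "a \<le> 1/3" and I: "(l, r) \<in> distinguished a k" and J: "(l', r') \<in> distinguished a k"
  shows "(l, r) = (l', r') \<or> r \<le> l' \<or> r' \<le> l"
  using I J
proof (induction k arbitrary: l r l' r')
  case (Suc k)
  obtain l0 r0 where I0: "(l0, r0) \<in> distinguished a k"
    and lr: "(l, r) \<in> {(l0, l0 + a * (r0 - l0)), (l0 + a * (r0 - l0), r0 - a * (r0 - l0)), (r0 - a * (r0 - l0), r0)}"
    using Suc.prems(1) by auto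
  obtain l1 r1 where I1: "(l1, r1) \<in> distinguished a k"
    and lr': "(l', r') \<in> {(l1, l1 + a * (r1 - l1)), (l1 + a * (r1 - l1), r1 - a * (r1 - l1)), (r1 - a * (r1 - l1), r1)}"
    using Suc.prems(2) by auto
  have I0': "l0 < r0" and I1': "l1 < r1" using distinguished_bounds[OF a I0] distinguished_bounds[OF a I1] by auto
  obtain d where d: "a * (r0 - l0) = d" "(r0 - l0) / 4 \<le> d" "d \<le> (r0 - l0) / 3"
    using subdivision_length[OF a I0'] .
  obtain d' where d': "a * (r1 - l1) = d'" "(r1 - l1) / 4 \<le> d'" "d' \<le> (r1 - l1) / 3"
    using subdivision_length[OF a I1'] .
  from Suc.IH[OF I0 I1] show ?case
  proof (elim disjE)
    assume "(l0, r0) = (l1, r1)"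
    then have eq: "l0 = l1" "r0 = r1" and dd: "d' = d" using d(1) d'(1) by auto
    show ?thesis using lr lr' I0' d(2,3) unfolding d(1) d'(1) unfolding eq dd by auto
  next
    have "l0 \<le> l" "r \<le> r0" using lr I0' d(2,3) unfolding d(1) by auto
    moreover have "l1 \<le> l'" "r' \<le> r1" using lr' I1' d'(2,3) unfolding d'(1) by auto
    ultimately show "r0 \<le> l1 \<Longrightarrow> ?thesis" "r1 \<le> l0 \<Longrightarrow> ?thesis" by auto
  qed
qed auto

lemma distinguished_ancestor:
  assumes a: "1/4 \<le> a" "a \<le> 1/3" and I: "(l, r) \<in> distinguished a (j + m)"
  shows "\<exists>l0 r0. (l0, r0) \<in> distinguished a j \<and> l0 \<le> l \<and> r \<le> r0"
  using I
proof (induction m arbitrary: l r)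
  case (Suc m)
  then obtain l1 r1 where I1: "(l1, r1) \<in> distinguished a (j + m)"
    and lr: "(l, r) \<in> {(l1, l1 + a * (r1 - l1)), (l1 + a * (r1 - l1), r1 - a * (r1 - l1)), (r1 - a * (r1 - l1), r1)}"
    by auto
  have I1': "l1 < r1" using distinguished_bounds[OF a I1] by auto
  obtain d where d: "a * (r1 - l1) = d" "(r1 - l1) / 4 \<le> d" "d \<le> (r1 - l1) / 3"
    using subdivision_length[OF a I1'] .
  then have "l1 \<le> l" "r \<le> r1" using lr I1' unfolding d(1) by auto
  then show ?case using Suc.IH[OF I1] by force
qed auto

lemma birth_outside_later:
  assumes a: "1/4 \<le> a" "a \<le> 1/3" and x: "birth a j x e" and jk: "j < k" and J: "(l', r') \<in> distinguished a k"
  shows "x \<le> l' \<or> r' \<le> x"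
proof -
  obtain l r where I: "(l, r) \<in> distinguished a j" "x \<in> {l + a * (r - l), r - a * (r - l)}"
    using x by (auto simp: birth_def)
  obtain m where "k = Suc j + m" using jk by (metis less_iff_Suc_add add_Suc)
  then obtain l1 r1 where I1: "(l1, r1) \<in> distinguished a (Suc j)" "l1 \<le> l'" "r' \<le> r1"
    using distinguished_ancestor[OF a, of l' r' "Suc j" m] J by blast
  then obtain l2 r2 where I2: "(l2, r2) \<in> distinguished a j"
    and lr: "(l1, r1) \<in> {(l2, l2 + a * (r2 - l2)), (l2 + a * (r2 - l2), r2 - a * (r2 - l2)), (r2 - a * (r2 - l2), r2)}"
    by auto
  have I0': "l < r" and I2': "l2 < r2" using distinguished_bounds[OF a I(1)] distinguished_bounds[OF a I2] by auto
  obtain d where d: "a * (r - l) = d" "(r - l) / 4 \<le> d" "d \<le> (r - l) / 3"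
    using subdivision_length[OF a I0'] .
  obtain d' where d': "a * (r2 - l2) = d'" "(r2 - l2) / 4 \<le> d'" "d' \<le> (r2 - l2) / 3"
    using subdivision_length[OF a I2'] .
  from distinguished_nonoverlapping[OF a I(1) I2] have "x \<le> l1 \<or> r1 \<le> x"
  proof (elim disjE)
    assume "(l, r) = (l2, r2)"
    then have eq: "l = l2" "r = r2" and dd: "d' = d" using d(1) d'(1) by auto
    show ?thesis using I(2) lr d(2,3) I0' unfolding d(1) d'(1) unfolding eq dd by auto
  next
    have "l \<le> x" "x \<le> r" using I(2) I0' d(2,3) unfolding d(1) by auto
    moreover have "l2 \<le> l1" "r1 \<le> r2" using lr I2' d'(2,3) unfolding d'(1) by auto
    ultimately show "r \<le> l2 \<Longrightarrow> ?thesis" "r2 \<le> l \<Longrightarrow> ?thesis" by auto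
  qed
  then show ?thesis using I1 by linarith
qed

text \<open>A point born earlier lies outside the open intervals of the later stage, so a point born later is
  separated from it by at least one outer subinterval of the interval in which it is born. Two
  births in the same interval are separated by the middle subinterval, which is at least as long as
  an outer one because \<open>a \<le> 1/3\<close>.\<close>

lemma births_separated:
  assumes a: "1/4 \<le> a" "a \<le> 1/3" and x: "birth a j x e" and y: "birth a k y e'" and jk: "j \<le> k"
  shows "x = y \<and> e = e' \<or> a * e' \<le> \<bar>x - y\<bar>"
proof -
  obtain l r where I: "(l, r) \<in> distinguished a j" "x \<in> {l + a * (r - l), r - a * (r - l)}" "e = r - l"
    using x by (auto simp: birth_def)
  obtain l' r' where J: "(l', r') \<in> distinguished a k" "y \<in> {l' + a * (r' - l'), r' - a * (r' - l')}" "e' = r' - l'"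
    using y by (auto simp: birth_def)
  have I0': "l < r" and J': "l' < r'" using distinguished_bounds[OF a I(1)] distinguished_bounds[OF a J(1)] by auto
  obtain d where d: "a * (r - l) = d" "(r - l) / 4 \<le> d" "d \<le> (r - l) / 3"
    using subdivision_length[OF a I0'] .
  obtain d' where d': "a * (r' - l') = d'" "(r' - l') / 4 \<le> d'" "d' \<le> (r' - l') / 3"
    using subdivision_length[OF a J'] .
  have out: "a * e' \<le> \<bar>x - y\<bar>" if "x \<le> l' \<or> r' \<le> x"
    using that J(2) d'(2,3) J' unfolding J(3) d'(1) by auto
  show ?thesis
  proof (cases "j = k")
    case True
    then consider "(l, r) = (l', r')" | "r \<le> l' \<or> r' \<le> l"
      using distinguished_nonoverlapping[OF a I(1), of l' r'] J(1) by auto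
    then show ?thesis
    proof cases
      case 1
      then have eq: "l = l'" "r = r'" by simp_all
      show ?thesis using I(2) J(2) d'(2,3) J' unfolding I(3) J(3) eq d'(1) by auto
    next
      case 2
      then have "x \<le> l' \<or> r' \<le> x" using I(2) d(2,3) I0' unfolding d(1) by auto
      then show ?thesis using out by blast
    qed
  next
    case False
    then show ?thesis using birth_outside_later[OF a x _ J(1)] jk out by simp
  qed
qed

lemma birth_bounds:
  assumes a: "1/4 \<le> a" "a \<le> 1/3" and x: "birth a k x e"
  shows "0 < e" "e \<le> (1/2) ^ k" "0 \<le> x - a * e" "x + a * e \<le> 1"
proof -
  obtain l r where I: "(l, r) \<in> distinguished a k" "x \<in> {l + a * (r - l), r - a * (r - l)}" "e = r - l"
    using x by (auto simp: birth_def)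
  note I' = distinguished_bounds[OF a I(1)]
  then obtain d where d: "a * (r - l) = d" "(r - l) / 4 \<le> d" "d \<le> (r - l) / 3"
    using subdivision_length[OF a, of l r] by blast
  show "0 < e" "e \<le> (1/2) ^ k" using I' I by auto
  show "0 \<le> x - a * e" "x + a * e \<le> 1" using I(2) I' d(2,3) unfolding I(3) d(1) by auto
qed

lemma tooth_pos:
  assumes a: "1/4 \<le> a" "a \<le> 1/3" and c: "0 < c" and x: "tooth a c x h"
  shows "0 < h" "0 \<le> x" "x \<le> 1"
proof -
  show "0 < h" using x a c birth_bounds(1)[OF a] unfolding tooth_def by (auto intro!: mult_pos_pos)
  have "0 \<le> x \<and> x \<le> 1" if "birth a k x e" for k e
  proof -
    have "0 \<le> a * e" using birth_bounds(1)[OF a that] a by simp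
    then show ?thesis using birth_bounds(3,4)[OF a that] by linarith
  qed
  then show "0 \<le> x" "x \<le> 1" using x unfolding tooth_def by auto
qed

text \<open>The segment attached at a birth is by the factor \<open>c\<close> shorter than an outer subinterval. In
  particular at most one upward segment is attached at each point.\<close>

lemma teeth_separated:
  assumes a: "1/4 \<le> a" "a \<le> 1/3" and c: "0 < c" "c < 1" and x: "tooth a c x h" and y: "tooth a c y h'"
  shows "x = y \<and> h = h' \<or> min h h' \<le> \<bar>x - y\<bar>"
proof -
  have small: "c * a * e \<le> a * e" if "birth a k x e" for k x e
    using c a birth_bounds(1)[OF a that] by (simp add: mult_le_cancel_right2)
  have ends: "min h h' \<le> \<bar>x - y\<bar>" if x: "x \<in> {0, 1}" and y: "birth a k y e" "h' = c * a * e" for x y h h' k e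
    using birth_bounds(3,4)[OF a y(1)] small[OF y(1)] x y(2) by auto
  show ?thesis
    using x unfolding tooth_def
  proof (elim disjE exE conjE)
    assume x: "x \<in> {0, 1}" "h = c"
    show ?thesis using y unfolding tooth_def
    proof (elim disjE exE conjE)
      assume "y \<in> {0, 1}" "h' = c"
      then show ?thesis using x c by auto
    qed (use x ends in blast)
  next
    fix k e assume x: "birth a k x e" "h = c * a * e"
    show ?thesis using y unfolding tooth_def
    proof (elim disjE exE conjE)
      assume "y \<in> {0, 1}" "h' = c"
      then show ?thesis using ends[of y k x e h h'] x by (simp add: min.commute abs_minus_commute)
    next
      fix k' e' assume y: "birth a k' y e'" "h' = c * a * e'"
      show ?thesis
      proof (cases "k \<le> k'")
        case True
        then show ?thesis using births_separated[OF a x(1) y(1)] small[OF y(1)] x(2) y(2) by auto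
      next
        case False
        then show ?thesis using births_separated[OF a y(1) x(1)] small[OF x(1)] x(2) y(2) by auto
      qed
    qed
  qed
qed

lemma finite_large_teeth:
  assumes a: "1/4 \<le> a" "a \<le> 1/3" and c: "0 < c" "c < 1" and d: "0 < d"
  shows "finite {(x, h). tooth a c x h \<and> d \<le> h}"
proof -
  obtain n where n: "(1/2::real) ^ n < d" using real_arch_pow_inv[OF d, of "1/2"] by auto
  have fin: "finite (distinguished a k)" for k by (induction k) auto
  define B where "B = {(0, c), (1, c)} \<union> (\<Union>k<n. \<Union>(l, r)\<in>distinguished a k.
     {(l + a * (r - l), c * a * (r - l)), (r - a * (r - l), c * a * (r - l))})"
  have "finite B" unfolding B_def using fin by auto
  moreover have "{(x, h). tooth a c x h \<and> d \<le> h} \<subseteq> B"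
  proof clarify
    fix x h assume x: "tooth a c x h" "d \<le> h"
    show "(x, h) \<in> B" using x(1) unfolding tooth_def
    proof (elim disjE exE conjE)
      fix k e assume y: "birth a k x e" "h = c * a * e"
      have "c * a \<le> 1 * 1" using a c by (intro mult_mono) auto
      then have "h \<le> 1 * e" unfolding y(2) using birth_bounds(1)[OF a y(1)] by (intro mult_right_mono) auto
      then have "d \<le> (1/2) ^ k" using birth_bounds(2)[OF a y(1)] x(2) by linarith
      moreover have "(1/2::real) ^ k \<le> (1/2) ^ n" if "n \<le> k" using that by (intro power_decreasing) auto
      ultimately have "k < n" using n by (meson linorder_not_less order_trans not_le)
      moreover obtain l r where "(l, r) \<in> distinguished a k" "x \<in> {l + a * (r - l), r - a * (r - l)}" "e = r - l"
        using y(1) unfolding birth_def by blast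
      ultimately show "(x, h) \<in> B" unfolding B_def y(2) by blast
    qed (auto simp: B_def)
  qed
  ultimately show ?thesis using finite_subset by blast
qed

lemma mem_T_tree:
  "River x y \<in> T_tree a c \<longleftrightarrow>
     y = 0 \<and> 0 \<le> x \<and> x \<le> 1 \<or> (\<exists>h. tooth a c x h \<and> 0 \<le> y \<and> y \<le> h) \<or> x \<in> {0, 1} \<and> - c \<le> y \<and> y \<le> 0"
    (is "?L \<longleftrightarrow> ?R")
proof
  have "?R" if "River x y \<in> tree_stage a c k" for k
    using that
  proof (induction k)
    case 0
    then show ?case unfolding tooth_def by auto
  next
    case (Suc k)
    then show ?case
    proof (cases "River x y \<in> tree_stage a c k")
      case False
      then obtain l r where "(l, r) \<in> distinguished a k" "x \<in> {l + a * (r - l), r - a * (r - l)}" "0 \<le> y" "y \<le> c * a * (r - l)"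
        using Suc.prems by auto
      then have "tooth a c x (c * a * (r - l)) \<and> 0 \<le> y \<and> y \<le> c * a * (r - l)"
        unfolding tooth_def birth_def by blast
      then show ?thesis by blast
    qed (use Suc.IH in blast)
  qed
  then show "?L \<Longrightarrow> ?R" unfolding T_tree_def by blast
next
  assume R: ?R
  have stage: "River x y \<in> tree_stage a c k \<Longrightarrow> ?L" for k unfolding T_tree_def by blast
  from R show ?L
  proof (elim disjE exE conjE)
    assume "y = 0" "0 \<le> x" "x \<le> 1"
    then have "River x y \<in> tree_stage a c 0" by auto
    then show ?L by (rule stage)
  next
    assume x: "x \<in> {0, 1}" "- c \<le> y" "y \<le> 0"
    have "River x y \<in> {River x (- s) |x s. x \<in> {0, 1} \<and> 0 \<le> s \<and> s \<le> c}"
      using x by (intro CollectI exI[of _ x] exI[of _ "- y"]) auto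
    then have "River x y \<in> tree_stage a c 0" unfolding tree_stage.simps by blast
    then show ?L by (rule stage)
  next
    fix h assume h: "tooth a c x h" "0 \<le> y" "y \<le> h"
    show ?L using h(1) unfolding tooth_def
    proof (elim disjE exE conjE)
      assume "x \<in> {0, 1}" "h = c"
      then have "River x y \<in> tree_stage a c 0" using h unfolding tree_stage.simps by blast
      then show ?L by (rule stage)
    next
      fix k e assume "birth a k x e" "h = c * a * e"
      then have "River x y \<in> tree_stage a c (Suc k)"
        using h unfolding birth_def tree_stage.simps by blast
      then show ?L by (rule stage)
    qed
  qed
qed

lemma comb_T_tree:
  assumes a: "1/4 \<le> a" "a \<le> 1/3" and c: "0 < c"
  shows "comb (T_tree a c)"
proof -
  have "{x. River x 0 \<in> T_tree a c} = {0..1}"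
    using tooth_pos[OF a c] c by (auto simp: mem_T_tree)
  moreover have "River x y' \<in> T_tree a c" if "River x y \<in> T_tree a c" "y' \<in> closed_segment 0 y" for x y y'
    using that unfolding mem_T_tree closed_segment_eq_real_ivl by (fastforce split: if_splits)
  moreover have "is_interval {0..1::real}" by (rule is_interval_cc)
  ultimately show ?thesis unfolding comb_def by (metis (no_types, lifting))
qed

lemma compact_T_tree:
  assumes a: "1/4 \<le> a" "a \<le> 1/3" and c: "0 < c" "c < 1"
  shows "compact (T_tree a c)"
proof (rule compact_if_compact_core)
  have horiz: "continuous_on A (\<lambda>x. River x 0)" for A
    unfolding continuous_on_iff by (auto simp: dist_river_def dist_real_def)
  have vert: "continuous_on A (\<lambda>y. River x y)" for A x
    unfolding continuous_on_iff by (auto simp: dist_river_def dist_real_def)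
  define R where "R = (\<lambda>x. River x 0) ` {0..1::real}"
  show "compact R" unfolding R_def by (intro compact_continuous_image horiz) auto
  show "R \<subseteq> T_tree a c" unfolding R_def by (auto simp: mem_T_tree)
  fix e :: real assume e: "0 < e"
  define K where "K = River 0 ` {-c..0} \<union> River 1 ` {-c..0} \<union> (\<Union>(x, h)\<in>{(x, h). tooth a c x h \<and> e \<le> h}. River x ` {0..h})"
  have "compact (River x ` {u..v})" for x u v by (intro compact_continuous_image vert) auto
  then have "compact K" unfolding K_def using finite_large_teeth[OF a c e] by (intro compact_Un compact_UN) auto
  moreover have "K \<subseteq> T_tree a c" unfolding K_def by (auto simp: mem_T_tree)
  moreover have "\<exists>q\<in>R. dist p q < e" if p: "p \<in> T_tree a c - K" for p
  proof -
    obtain x y where xy: "p = River x y" by (cases p)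
    consider "y = 0" "0 \<le> x" "x \<le> 1" | h where "tooth a c x h" "0 \<le> y" "y \<le> h" | "x \<in> {0, 1}" "- c \<le> y" "y \<le> 0"
      using p unfolding xy mem_T_tree Diff_iff by blast
    then show ?thesis
    proof cases
      case 1
      then show ?thesis using e unfolding R_def xy by (intro bexI[of _ "River x 0"]) auto
    next
      case (2 h)
      have "p \<in> K" if "e \<le> h"
      proof -
        have "p \<in> River x ` {0..h}" using 2 by (simp add: xy)
        then show ?thesis unfolding K_def using 2(1) that by blast
      qed
      then have "\<not> e \<le> h" using p by blast
      moreover have "River x 0 \<in> R" using tooth_pos[OF a c(1) 2(1)] unfolding R_def by auto
      ultimately show ?thesis using 2 unfolding xy by (intro bexI[of _ "River x 0"]) (auto simp: dist_river_def)
    next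
      case 3
      then have "p \<in> K" unfolding K_def xy by auto
      then show ?thesis using p by blast
    qed
  qed
  ultimately show "\<exists>K. compact K \<and> K \<subseteq> T_tree a c \<and> (\<forall>x\<in>T_tree a c - K. \<exists>y\<in>R. dist x y < e)" by blast
qed

text \<open>Downward segments exist only at the two ends of the river segment, and there the river continues
  in one direction only; so no point has more than three directions, and no point has three
  directions unless it lies on the river and an upward segment is attached to it.\<close>

lemma T_tree_directions:
  assumes a: "1/4 \<le> a" "a \<le> 1/3" and c: "0 < c" and z: "z \<in> T_tree a c"
  obtains D where "river_direction z ` (T_tree a c - {z}) \<subseteq> D" "finite D" "card D \<le> 3"
    "card (D - {2}) \<le> 2" "ordinate z \<noteq> 0 \<longrightarrow> card D \<le> 2"
proof -
  obtain x y where xy: "z = River x y" by (cases z)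
  have x01: "0 \<le> u \<and> u \<le> 1 \<and> (v < 0 \<longrightarrow> u \<in> {0, 1})" if "River u v \<in> T_tree a c" for u v
    using that unfolding mem_T_tree
  proof (elim disjE exE conjE)
    fix h assume "tooth a c u h" "0 \<le> v" "v \<le> h"
    then show ?thesis using tooth_pos(2,3)[OF a c, of u h] by simp
  qed auto
  have q: "\<exists>u v. q = River u v \<and> 0 \<le> u \<and> u \<le> 1 \<and> (v < 0 \<longrightarrow> u \<in> {0, 1})" if "q \<in> T_tree a c" for q
    using x01 that by (metis river.exhaust)
  consider "y \<noteq> 0" | "y = 0" "x = 0" | "y = 0" "x = 1" | "y = 0" "x \<notin> {0, 1}" by blast
  then show thesis
  proof cases
    case 1
    show thesis by (rule that[of "{0, 1}"]) (use 1 in \<open>auto simp: xy river_direction_def\<close>)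
  next
    case 2
    show thesis
    proof (rule that[of "{1, 2, 3}"])
      have "river_direction z p \<in> {1, 2, 3}" if p: "p \<in> T_tree a c" for p
      proof -
        obtain u v where "p = River u v" "0 \<le> u" "u \<le> 1" using q[OF p] by blast
        then show ?thesis using 2 by (auto simp: xy river_direction_def)
      qed
      then show "river_direction z ` (T_tree a c - {z}) \<subseteq> {1, 2, 3}" by blast
    qed (use 2 in \<open>auto simp: xy\<close>)
  next
    case 3
    show thesis
    proof (rule that[of "{0, 2, 3}"])
      have "river_direction z p \<in> {0, 2, 3}" if p: "p \<in> T_tree a c" for p
      proof -
        obtain u v where "p = River u v" "0 \<le> u" "u \<le> 1" using q[OF p] by blast
        then show ?thesis using 3 by (auto simp: xy river_direction_def)
      qed
      then show "river_direction z ` (T_tree a c - {z}) \<subseteq> {0, 2, 3}" by blast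
    qed (use 3 in \<open>auto simp: xy\<close>)
  next
    case 4
    show thesis
    proof (rule that[of "{0, 1, 2}"])
      have "river_direction z p \<in> {0, 1, 2}" if p: "p \<in> T_tree a c" "p \<noteq> z" for p
      proof -
        obtain u v where uv: "p = River u v" "v < 0 \<longrightarrow> u \<in> {0, 1}" using q[OF p(1)] by blast
        have "\<not> (u = x \<and> v \<le> 0)" using uv 4 p(2) xy by auto
        then show ?thesis using 4 by (auto simp: xy uv river_direction_def)
      qed
      then show "river_direction z ` (T_tree a c - {z}) \<subseteq> {0, 1, 2}" by blast
    qed (use 4 in \<open>auto simp: xy\<close>)
  qed
qed

lemma T_tree_valence_le:
  assumes a: "1/4 \<le> a" "a \<le> 1/3" and c: "0 < c" and z: "z \<in> T_tree a c"
  shows "valence (T_tree a c) z \<le> enat 3"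
proof -
  obtain D where "river_direction z ` (T_tree a c - {z}) \<subseteq> D" "finite D" "card D \<le> 3"
    by (rule T_tree_directions[OF assms])
  then have "card (branches (T_tree a c) z) \<le> 3"
    unfolding comb_card_branches[OF comb_T_tree[OF a c]] using card_mono order_trans by blast
  then show ?thesis using comb_card_branches(1)[OF comb_T_tree[OF a c]] by (simp add: valence_def)
qed

text \<open>A branch point uses the upward direction, so one of its three branches is contained in the
  attached segment, and the third branch is not larger than that one.\<close>

lemma T_tree_branch_point:
  assumes a: "1/4 \<le> a" "a \<le> 1/3" and c: "0 < c" "c < 1" and z: "z \<in> branch_points (T_tree a c)"
  shows "\<exists>x h. z = River x 0 \<and> tooth a c x h \<and> branch_height (T_tree a c) z \<le> h"
proof -
  let ?T = "T_tree a c"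
  note T = comb_T_tree[OF a c(1)]
  have zT: "z \<in> ?T" "3 \<le> valence ?T z" using z by (auto simp: branch_points_def)
  have card: "card (branches ?T z) = 3"
    using T_tree_valence_le[OF a c(1) zT(1)] zT(2) comb_card_branches(1)[OF T]
    by (simp add: valence_def numeral_eq_enat)
  obtain D where D: "river_direction z ` (?T - {z}) \<subseteq> D" "finite D" "card D \<le> 3" "card (D - {2}) \<le> 2" "ordinate z \<noteq> 0 \<longrightarrow> card D \<le> 2"
    by (rule T_tree_directions[OF a c(1) zT(1)])
  have D3: "3 \<le> card E" if "river_direction z ` (?T - {z}) \<subseteq> E" "finite E" for E
    using card comb_card_branches(2)[OF T, of z] card_mono[OF that(2,1)] by simp
  have "\<not> card D \<le> 2" using D3[OF D(1,2)] by linarith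
  then have oz: "ordinate z = 0" using D(5) by blast
  then obtain x where x: "z = River x 0" by (cases z) auto
  have "\<not> river_direction z ` (?T - {z}) \<subseteq> D - {2}"
  proof
    assume "river_direction z ` (?T - {z}) \<subseteq> D - {2}"
    from D3[OF this] D(2) have "3 \<le> card (D - {2})" by blast
    then show False using D(4) by linarith
  qed
  then obtain d where d: "d \<in> river_direction z ` (?T - {z})" "d \<notin> D - {2}" by (meson subsetI)
  then have "d = 2" using D(1) by (metis Diff_iff insertE empty_iff subsetD singletonI)
  then obtain q where q: "q \<in> ?T - {z}" "river_direction z q = 2" using d(1) by (metis imageE)
  obtain y where y: "q = River x y" "0 < y"
    using q by (cases q) (auto simp: x river_direction_def split: if_splits)
  then obtain h where h: "tooth a c x h" "y \<le> h" using q(1) by (auto simp: mem_T_tree)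
  define B where "B = connected_component_set (?T - {z}) q"
  have B: "B \<in> branches ?T z" unfolding B_def using q(1) by (rule componentsI)
  have mem: "\<exists>s. p = River x s \<and> 0 < s \<and> s \<le> h" if "p \<in> B" for p
  proof -
    have p: "p \<in> ?T - {z}" using that B in_components_subset by blast
    have "river_direction z p = 2"
      using comb_same_branch_iff[OF T q(1) p] that q(2) by (simp add: B_def)
    then obtain s where s: "p = River x s" "0 < s"
      by (cases p) (auto simp: x river_direction_def split: if_splits)
    then obtain h' where h': "tooth a c x h'" "s \<le> h'" using p by (auto simp: mem_T_tree)
    then have "h' = h"
      using teeth_separated[OF a c h'(1) h(1)] tooth_pos(1)[OF a c(1) h'(1)] tooth_pos(1)[OF a c(1) h(1)] by auto
    then show ?thesis using s h' by blast
  qed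
  have "q \<in> B" using q(1) by (simp add: B_def connected_component_refl)
  have "diameter B \<le> h"
    unfolding diameter_def
  proof (simp, intro conjI impI)
    show "(SUP (x, y)\<in>B \<times> B. dist x y) \<le> h"
    proof (rule cSUP_least)
      show "B \<times> B \<noteq> {}" using \<open>q \<in> B\<close> by auto
      fix w assume w: "w \<in> B \<times> B"
      obtain u v where uv: "w = (u, v)" "u \<in> B" "v \<in> B" using w by (cases w) auto
      obtain s t where "u = River x s" "v = River x t" "0 < s" "s \<le> h" "0 < t" "t \<le> h"
        using mem[OF uv(2)] mem[OF uv(3)] by blast
      then show "(case w of (x, y) \<Rightarrow> dist x y) \<le> h" unfolding uv(1) by (simp add: dist_river_def)
    qed
  qed (use \<open>q \<in> B\<close> in auto)
  then have "branch_height ?T z \<le> h" using branch_height_le[OF card B] by linarith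
  then show ?thesis using x h by blast
qed

lemma T_tree_in_geodesic_trees:
  assumes a: "1/4 \<le> a" "a \<le> 1/3" and c: "0 < c" "c < 1" and n: "3 \<le> n"
  shows "T_tree a c \<in> geodesic_trees n c"
  unfolding geodesic_trees_def
proof (intro CollectI conjI ballI impI)
  show "geodesic_tree (T_tree a c)"
    by (rule comb_geodesic_tree[OF comb_T_tree[OF a c(1)] compact_T_tree[OF a c]])
  have "valence (T_tree a c) p \<le> enat n" if "p \<in> T_tree a c" for p
    using T_tree_valence_le[OF a c(1) that] n by (meson enat_ord_simps(1) order_trans)
  then show "Val (T_tree a c) \<le> enat n" unfolding Val_def by (rule SUP_least)
  fix p q assume pq: "p \<in> branch_points (T_tree a c)" "q \<in> branch_points (T_tree a c)" "p \<noteq> q"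
  obtain x h where x: "p = River x 0" "tooth a c x h" "branch_height (T_tree a c) p \<le> h"
    using T_tree_branch_point[OF a c pq(1)] by blast
  obtain y h' where y: "q = River y 0" "tooth a c y h'" "branch_height (T_tree a c) q \<le> h'"
    using T_tree_branch_point[OF a c pq(2)] by blast
  have "min h h' \<le> \<bar>x - y\<bar>" using teeth_separated[OF a c x(2) y(2)] pq(3) x(1) y(1) by auto
  moreover have "0 < min h h'" using tooth_pos(1)[OF a c(1)] x(2) y(2) by auto
  moreover have "c * min (branch_height (T_tree a c) p) (branch_height (T_tree a c) q) \<le> c * min h h'"
    using x(3) y(3) c(1) by (intro mult_left_mono) auto
  moreover have "c * min h h' \<le> 1 * min h h'" using c calculation(2) by (intro mult_right_mono) auto
  moreover have "dist p q = \<bar>x - y\<bar>" using pq(3) by (simp add: x(1) y(1) dist_river_def)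
  ultimately show "c * min (branch_height (T_tree a c) p) (branch_height (T_tree a c) q) \<le> dist p q" by linarith
qed

section \<open>Bi-Lipschitz images of the river segment\<close>

text \<open>The distinguished intervals inside the middle interval of the first subdivision, addressed by words
  whose first letter is the most recent choice. Starting at \<open>[a, 1 - a]\<close> rather than at
  \<open>[0, 1]\<close> makes all end points births, so that the ends of the river segment need no separate
  treatment. Intervals with the same word for different \<open>a\<close> correspond to each other.\<close>

fun cell :: "real \<Rightarrow> nat list \<Rightarrow> real \<times> real" where
  "cell a [] = (a, 1 - a)"
| "cell a (i # w) =
    (let l = fst (cell a w); r = snd (cell a w); d = a * (r - l)
     in if i = 0 then (l, l + d) else if i = 1 then (l + d, r - d) else (r - d, r))"

abbreviation left_end :: "real \<Rightarrow> nat list \<Rightarrow> real" where "left_end a w \<equiv> fst (cell a w)"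
abbreviation right_end :: "real \<Rightarrow> nat list \<Rightarrow> real" where "right_end a w \<equiv> snd (cell a w)"
abbreviation cell_length :: "real \<Rightarrow> nat list \<Rightarrow> real" where "cell_length a w \<equiv> right_end a w - left_end a w"

lemma cell_distinguished: "cell a w \<in> distinguished a (Suc (length w))"
proof (induction w)
  case (Cons i w)
  obtain l r where lr: "cell a w = (l, r)" by (cases "cell a w")
  have "cell a (i # w) \<in> {(l, l + a * (r - l)), (l + a * (r - l), r - a * (r - l)), (r - a * (r - l), r)}"
    by (auto simp: lr Let_def)
  then show ?case using Cons.IH unfolding lr by (auto simp del: cell.simps)
qed auto

lemma cell_bounds:
  assumes a: "1/4 \<le> a" "a \<le> 1/3"
  shows "0 \<le> left_end a w" "left_end a w < right_end a w" "right_end a w \<le> 1"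
  using distinguished_bounds[OF a, of "left_end a w" "right_end a w" "Suc (length w)"] cell_distinguished[of a w]
  by auto

lemma cell_inner_births:
  "birth a (Suc (length w)) (right_end a (0 # w)) (cell_length a w)"
  "birth a (Suc (length w)) (left_end a (2 # w)) (cell_length a w)"
  unfolding birth_def using cell_distinguished[of a w]
  by (intro exI[of _ "left_end a w"] exI[of _ "right_end a w"]; simp add: Let_def)+

lemma cell_end_births:
  "(\<exists>k e. birth a k (left_end a w) e) \<and> (\<exists>k e. birth a k (right_end a w) e)"
proof (induction w)
  case Nil
  have "birth a 0 a 1" "birth a 0 (1 - a) 1" by (auto simp: birth_def)
  then show ?case by auto
next
  case (Cons i w)
  have "left_end a (i # w) \<in> {left_end a w, right_end a (0 # w), left_end a (2 # w)}"
    "right_end a (i # w) \<in> {right_end a w, right_end a (0 # w), left_end a (2 # w)}"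
    by (auto simp: Let_def)
  then show ?case using Cons.IH cell_inner_births[of a w] by (metis insertE singletonD)
qed

definition bi_Lipschitz_const :: "real \<Rightarrow> 'a::metric_space set \<Rightarrow> 'b::metric_space set \<Rightarrow> ('a \<Rightarrow> 'b) \<Rightarrow> bool" where
  "bi_Lipschitz_const N X Y f \<longleftrightarrow> f ` X \<subseteq> Y \<and>
     (\<forall>x\<in>X. \<forall>y\<in>X. dist x y / N \<le> dist (f x) (f y) \<and> dist (f x) (f y) \<le> N * dist x y)"

lemma bi_Lipschitz_embedding_const:
  assumes "bi_Lipschitz_embedding X Y f"
  obtains N :: nat where "1 \<le> N" "bi_Lipschitz_const (real N) X Y f"
proof -
  obtain k K where k: "0 < k" "0 < K" and f: "f ` X \<subseteq> Y"
    "\<And>x y. x \<in> X \<Longrightarrow> y \<in> X \<Longrightarrow> 1 / k * dist x y \<le> dist (f x) (f y) \<and> dist (f x) (f y) \<le> K * dist x y"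
    using assms unfolding bi_Lipschitz_embedding_def by blast
  obtain N :: nat where N: "max 1 (max k K) < real N" using reals_Archimedean2 by blast
  have "dist x y / real N \<le> dist (f x) (f y)" "dist (f x) (f y) \<le> real N * dist x y" if "x \<in> X" "y \<in> X" for x y
  proof -
    have "dist x y / real N \<le> dist x y / k" using k N by (intro divide_left_mono) auto
    then show "dist x y / real N \<le> dist (f x) (f y)" using f(2)[OF that] by simp
    have "K * dist x y \<le> real N * dist x y" using N by (intro mult_right_mono) auto
    then show "dist (f x) (f y) \<le> real N * dist x y" using f(2)[OF that] by linarith
  qed
  then show thesis using N f(1) that[of N] unfolding bi_Lipschitz_const_def by auto
qed

lemma bi_Lipschitz_arc:
  fixes f :: "'a::metric_space \<Rightarrow> 'b::metric_space"
  assumes f: "bi_Lipschitz_const N X Y f" "0 < N"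
    and \<sigma>: "\<sigma> ` {0..1} \<subseteq> X" "\<And>s t. s \<in> {0..1} \<Longrightarrow> t \<in> {0..1} \<Longrightarrow> dist (\<sigma> s) (\<sigma> t) = e * \<bar>s - t\<bar>" and e: "0 < e"
  shows "arc (f \<circ> \<sigma>)" "path_image (f \<circ> \<sigma>) \<subseteq> Y" "e / N \<le> dist (f (\<sigma> 0)) (f (\<sigma> 1))"
proof -
  have low: "e * \<bar>s - t\<bar> / N \<le> dist (f (\<sigma> s)) (f (\<sigma> t))"
    and up: "dist (f (\<sigma> s)) (f (\<sigma> t)) \<le> N * (e * \<bar>s - t\<bar>)" if "s \<in> {0..1}" "t \<in> {0..1}" for s t
    using f(1) \<sigma>(1) \<sigma>(2)[OF that] that unfolding bi_Lipschitz_const_def by (metis image_subset_iff)+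
  have "(N * e)-lipschitz_on {0..1} (f \<circ> \<sigma>)"
    using up f(2) e by (intro lipschitz_onI) (auto simp: dist_real_def mult.assoc)
  then have "path (f \<circ> \<sigma>)" unfolding path_def by (rule lipschitz_on_continuous_on)
  moreover have "inj_on (f \<circ> \<sigma>) {0..1}"
  proof (rule inj_onI)
    fix s t :: real assume st: "s \<in> {0..1}" "t \<in> {0..1}" "(f \<circ> \<sigma>) s = (f \<circ> \<sigma>) t"
    then have "e * \<bar>s - t\<bar> / N \<le> 0" using low[OF st(1,2)] by simp
    then have "\<bar>s - t\<bar> \<le> 0" using e f(2) by (simp add: divide_le_0_iff mult_le_0_iff)
    then show "s = t" by simp
  qed
  ultimately show "arc (f \<circ> \<sigma>)" by (simp add: arc_def)
  show "path_image (f \<circ> \<sigma>) \<subseteq> Y" using f(1) \<sigma>(1) unfolding bi_Lipschitz_const_def path_image_def by auto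
  show "e / N \<le> dist (f (\<sigma> 0)) (f (\<sigma> 1))" using low[of 0 1] by simp
qed

lemma bi_Lipschitz_inj:
  assumes "bi_Lipschitz_const N X Y f" "0 < N" "x \<in> X" "y \<in> X" "f x = f y"
  shows "x = y"
proof -
  have "dist x y / N \<le> 0" using assms unfolding bi_Lipschitz_const_def by (metis dist_self)
  then have "dist x y \<le> 0" using assms(2) by (simp add: divide_le_0_iff)
  then show ?thesis by simp
qed

lemma river_segment_arc:
  assumes f: "bi_Lipschitz_const N (T_tree a c) M f" "0 < N" and lr: "0 \<le> l" "l < r" "r \<le> 1"
  obtains g where "arc g" "path_image g \<subseteq> M" "pathstart g = f (River l 0)" "pathfinish g = f (River r 0)"
    "path_image g = (\<lambda>x. f (River x 0)) ` {l..r}"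
proof -
  define \<sigma> where "\<sigma> t = River (l + t * (r - l)) 0" for t
  have im: "(\<lambda>t. l + t * (r - l)) ` {0..1} = {l..r}"
  proof -
    have "l + t * (r - l) \<in> {l..r}" if "t \<in> {0..1}" for t
    proof -
      have "t * (r - l) \<le> r - l" "0 \<le> t * (r - l)"
        using that lr by (auto intro!: mult_left_le_one_le)
      then show ?thesis by simp
    qed
    moreover have "u \<in> (\<lambda>t. l + t * (r - l)) ` {0..1}" if "u \<in> {l..r}" for u
      using that lr by (intro image_eqI[of _ _ "(u - l) / (r - l)"]) auto
    ultimately show ?thesis by blast
  qed
  have \<sigma>im: "\<sigma> ` {0..1} = (\<lambda>x. River x 0) ` {l..r}" unfolding im[symmetric] \<sigma>_def by (simp add: image_image)
  have T: "\<sigma> ` {0..1} \<subseteq> T_tree a c" unfolding \<sigma>im using lr by (auto simp: mem_T_tree)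
  have d: "dist (\<sigma> s) (\<sigma> t) = (r - l) * \<bar>s - t\<bar>" for s t
  proof -
    have "dist (\<sigma> s) (\<sigma> t) = \<bar>s * (r - l) - t * (r - l)\<bar>" by (simp add: \<sigma>_def dist_river_def)
    also have "\<dots> = \<bar>(r - l) * (s - t)\<bar>" by (simp add: algebra_simps)
    finally show ?thesis using lr by (simp add: abs_mult)
  qed
  show thesis
  proof (rule that[of "f \<circ> \<sigma>"])
    show "arc (f \<circ> \<sigma>)" "path_image (f \<circ> \<sigma>) \<subseteq> M"
      using bi_Lipschitz_arc[OF f T, of "r - l"] d lr by auto
    show "path_image (f \<circ> \<sigma>) = (\<lambda>x. f (River x 0)) ` {l..r}"
      by (simp only: path_image_def image_comp[symmetric] \<sigma>im image_image)
  qed (simp_all add: pathstart_def pathfinish_def \<sigma>_def)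
qed

text \<open>The isometry onto an interval sends the ends of the arc to the ends of the interval, because it
  preserves their distance.\<close>

lemma geodesic_arc_dist:
  assumes M: "geodesic_tree M" and g: "arc g" "path_image g \<subseteq> M" and uv: "u \<in> path_image g" "v \<in> path_image g"
  shows "dist (pathstart g) u + dist u (pathfinish g) = dist (pathstart g) (pathfinish g)"
    "dist u v = \<bar>dist (pathstart g) u - dist (pathstart g) v\<bar>"
proof -
  define p q where "p = pathstart g" and "q = pathfinish g"
  have pq: "p \<in> path_image g" "q \<in> path_image g" unfolding p_def q_def by auto
  obtain \<phi> where \<phi>: "\<phi> ` path_image g = {0..dist p q}"
    "\<And>x y. x \<in> path_image g \<Longrightarrow> y \<in> path_image g \<Longrightarrow> \<bar>\<phi> x - \<phi> y\<bar> = dist x y"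
    using M g unfolding geodesic_tree_def isometric_def p_def q_def dist_real_def by metis
  have rng: "0 \<le> \<phi> x" "\<phi> x \<le> dist p q" if "x \<in> path_image g" for x using \<phi>(1) that by auto
  have "\<bar>\<phi> p - \<phi> q\<bar> = dist p q" using \<phi>(2) pq by blast
  then have ends: "\<phi> p = 0 \<and> \<phi> q = dist p q \<or> \<phi> p = dist p q \<and> \<phi> q = 0"
    using rng[OF pq(1)] rng[OF pq(2)] by linarith
  have "\<bar>\<phi> p - \<phi> u\<bar> = dist p u" "\<bar>\<phi> u - \<phi> q\<bar> = dist u q" "\<bar>\<phi> p - \<phi> v\<bar> = dist p v" "\<bar>\<phi> u - \<phi> v\<bar> = dist u v"
    using \<phi>(2) pq uv by blast+
  then have "dist p u + dist u q = dist p q" "dist u v = \<bar>dist p u - dist p v\<bar>"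
    using ends rng[OF uv(1)] rng[OF uv(2)] by linarith+
  then show "dist (pathstart g) u + dist u (pathfinish g) = dist (pathstart g) (pathfinish g)"
    "dist u v = \<bar>dist (pathstart g) u - dist (pathstart g) v\<bar>"
    by (simp_all add: p_def q_def)
qed

lemma river_dist_additive:
  assumes M: "geodesic_tree M" and f: "bi_Lipschitz_const N (T_tree a c) M f" "0 < N"
    and x: "0 \<le> l" "l \<le> x" "x \<le> r" "r \<le> 1"
  shows "dist (f (River l 0)) (f (River x 0)) + dist (f (River x 0)) (f (River r 0)) = dist (f (River l 0)) (f (River r 0))"
proof (cases "l < r")
  case True
  obtain g where g: "arc g" "path_image g \<subseteq> M" "pathstart g = f (River l 0)" "pathfinish g = f (River r 0)"
    "path_image g = (\<lambda>x. f (River x 0)) ` {l..r}"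
    using river_segment_arc[OF f x(1) True x(4)] .
  have "f (River x 0) \<in> path_image g" using g(5) x by auto
  then show ?thesis using geodesic_arc_dist(1)[OF M g(1,2)] g(3,4) by auto
next
  case False
  then have "l = x" "r = x" using x by auto
  then show ?thesis by simp
qed

text \<open>Both river segments are mapped onto the unique arc between the common end points, along which
  distances are differences of the distances to one end.\<close>

lemma river_dist_same_ends:
  assumes M: "geodesic_tree M"
    and f: "bi_Lipschitz_const N (T_tree a c) M f" "0 < N" and x: "0 \<le> l" "l < r" "r \<le> 1" "x \<in> {l..r}"
    and f': "bi_Lipschitz_const N (T_tree b c) M f'" and y: "0 \<le> l'" "l' < r'" "r' \<le> 1" "y \<in> {l'..r'}"
    and ends: "f (River l 0) = f' (River l' 0)" "f (River r 0) = f' (River r' 0)"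
  shows "dist (f (River x 0)) (f' (River y 0)) =
     \<bar>dist (f (River l 0)) (f (River x 0)) - dist (f' (River l' 0)) (f' (River y 0))\<bar>"
proof -
  obtain g where g: "arc g" "path_image g \<subseteq> M" "pathstart g = f (River l 0)" "pathfinish g = f (River r 0)"
    "path_image g = (\<lambda>x. f (River x 0)) ` {l..r}"
    using river_segment_arc[OF f x(1-3)] .
  obtain h where h: "arc h" "path_image h \<subseteq> M" "pathstart h = f' (River l' 0)" "pathfinish h = f' (River r' 0)"
    "path_image h = (\<lambda>x. f' (River x 0)) ` {l'..r'}"
    using river_segment_arc[OF f' f(2) y(1-3)] .
  have "metric_tree M" using M by (simp add: geodesic_tree_def)
  then have "path_image g = path_image h"
    by (rule metric_tree_arc_image_unique) (use g h ends in auto)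
  then have "f (River x 0) \<in> path_image g" "f' (River y 0) \<in> path_image g"
    using g(5) h(5) x y by auto
  from geodesic_arc_dist(2)[OF M g(1,2) this] show ?thesis using g(3) ends by simp
qed

text \<open>Three arcs of equal length leave the birth in the tree: to the left, to the right and up the
  attached segment. Their images form a tripod.\<close>

lemma birth_image_branch_point:
  assumes M: "M \<in> geodesic_trees n c'" and f: "bi_Lipschitz_const N (T_tree a c) M f" "0 < N"
    and a: "1/4 \<le> a" "a \<le> 1/3" and c: "0 < c" "c < 1" and x: "birth a k x e"
  shows "f (River x 0) \<in> branch_points M" "c * e / (4 * N) \<le> branch_height M (f (River x 0))"
proof -
  define z where "z = f (River x 0)"
  define h where "h = c * a * e"
  have e: "0 < e" "0 \<le> x - a * e" "x + a * e \<le> 1" using birth_bounds[OF a x] by auto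
  have h: "0 < h" "h \<le> a * e" unfolding h_def using a c e by (auto simp: mult_le_cancel_right2)
  have tooth: "tooth a c x h" unfolding tooth_def h_def using x by blast
  \<comment> \<open>All three legs are given the length h of the attached segment, which is the shortest of the three
    pieces of the tree around x.\<close>
  define \<sigma> where "\<sigma> i t = (if i = 0 then River (x - t * h) 0 else if i = 1 then River (x + t * h) 0 else River x (t * h))"
    for i :: nat and t
  have th: "0 \<le> t * h" "t * h \<le> h" if "t \<in> {0..1}" for t
    using that h by (auto simp: mult_left_le_one_le)
  have T: "\<sigma> i ` {0..1} \<subseteq> T_tree a c" if "i \<in> {0,1,2}" for i
  proof (rule image_subsetI)
    fix t :: real assume t: "t \<in> {0..1}"
    have "0 \<le> x - t * h" "x - t * h \<le> 1" "0 \<le> x + t * h" "x + t * h \<le> 1"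
      using th[OF t] e h tooth_pos(2,3)[OF a c(1) tooth] by linarith+
    then show "\<sigma> i t \<in> T_tree a c"
      using th[OF t] that tooth tooth_pos(2,3)[OF a c(1) tooth] by (auto simp: \<sigma>_def mem_T_tree)
  qed
  have d: "dist (\<sigma> i s) (\<sigma> i t) = h * \<bar>s - t\<bar>" for i s t
  proof -
    have "dist (\<sigma> i s) (\<sigma> i t) = \<bar>s * h - t * h\<bar>" by (auto simp: \<sigma>_def dist_river_def)
    also have "\<dots> = \<bar>h * (s - t)\<bar>" by (simp add: algebra_simps)
    finally show ?thesis using h by (simp add: abs_mult)
  qed
  have \<sigma>0: "\<sigma> i 0 = River x 0" for i by (simp add: \<sigma>_def)
  have geo: "geodesic_tree M" "Val M \<le> enat n" using M by (auto simp: geodesic_trees_def)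
  have tree: "metric_tree M" using geo(1) by (simp add: geodesic_tree_def)
  have zM: "z \<in> M" using f(1) T[of 0] \<sigma>0[of 0] unfolding z_def bi_Lipschitz_const_def by force
  have "valence M z \<le> Val M" unfolding Val_def using zM by (rule SUP_upper)
  then have "valence M z \<le> enat n" using geo(2) by order
  then have fin: "finite (branches M z)" by (auto simp: valence_def split: if_splits)
  have arcs: "arc (f \<circ> \<sigma> i) \<and> path_image (f \<circ> \<sigma> i) \<subseteq> M \<and> pathstart (f \<circ> \<sigma> i) = z \<and> h / N \<le> dist z (pathfinish (f \<circ> \<sigma> i))"
    if "i \<in> {0,1,2}" for i
    using bi_Lipschitz_arc[OF f T[OF that] d h(1)] \<sigma>0[of i] by (simp add: pathstart_def pathfinish_def z_def)
  have meet: "path_image (f \<circ> \<sigma> i) \<inter> path_image (f \<circ> \<sigma> j) \<subseteq> {z}" if ij: "i \<in> {0,1,2}" "j \<in> {0,1,2}" "i < j" for i j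
  proof
    fix p assume "p \<in> path_image (f \<circ> \<sigma> i) \<inter> path_image (f \<circ> \<sigma> j)"
    then obtain s t where st: "s \<in> {0..1}" "p = f (\<sigma> i s)" "t \<in> {0..1}" "p = f (\<sigma> j t)"
      by (auto simp: path_image_def)
    then have same: "\<sigma> i s = \<sigma> j t"
      using bi_Lipschitz_inj[OF f, of "\<sigma> i s" "\<sigma> j t"] T[OF ij(1)] T[OF ij(2)] by (metis image_subset_iff)
    moreover have "u \<le> 0 \<or> v \<le> 0" if "0 \<le> u" "0 \<le> v"
      "(if i = 0 then River (x - u) 0 else if i = 1 then River (x + u) 0 else River x u) =
       (if j = 0 then River (x - v) 0 else if j = 1 then River (x + v) 0 else River x v)" for u v
      using ij that by (auto split: if_splits)
    ultimately have "s * h \<le> 0 \<or> t * h \<le> 0"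
      unfolding \<sigma>_def using th(1)[OF st(1)] th(1)[OF st(3)] by blast
    then have "s * h = 0 \<or> t * h = 0"
      using th[OF st(1)] th[OF st(3)] by linarith
    then have "\<sigma> i s = River x 0" using same by (auto simp: \<sigma>_def split: if_splits)
    then show "p \<in> {z}" using st by (simp add: z_def)
  qed
  have "z \<in> branch_points M" "h / N \<le> branch_height M z"
    using tripod_branch_height[OF tree fin, of "\<lambda>i. f \<circ> \<sigma> i" "h / N"] arcs meet by blast+
  moreover have "c * e / (4 * N) \<le> h / N"
  proof -
    have "c * e * (1/4) \<le> c * e * a" using a c e by (intro mult_left_mono) auto
    then show ?thesis using f(2) by (simp add: h_def field_simps)
  qed
  ultimately show "f (River x 0) \<in> branch_points M" "c * e / (4 * N) \<le> branch_height M (f (River x 0))"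
    by (auto simp: z_def)
qed

section \<open>Comparison of two embeddings\<close>

text \<open>The setting of one embedding with an explicit constant. The image of a cell is an arc of length
  \<open>image_length\<close>.\<close>

locale T_tree_embedding =
  fixes M :: "'image_length::metric_space set" and n :: nat and c\<^sub>M c N a :: real and f :: "river \<Rightarrow> 'image_length"
  assumes M: "M \<in> geodesic_trees n c\<^sub>M" and c\<^sub>M: "0 < c\<^sub>M" and c: "0 < c" "c < 1" and N: "1 \<le> N"
    and a: "1/4 \<le> a" "a \<le> 1/3" and f: "bi_Lipschitz_const N (T_tree a c) M f"
begin

definition left_image :: "nat list \<Rightarrow> 'image_length" where "left_image w = f (River (left_end a w) 0)"
definition right_image :: "nat list \<Rightarrow> 'image_length" where "right_image w = f (River (right_end a w) 0)"
definition image_length :: "nat list \<Rightarrow> real" where "image_length w = dist (left_image w) (right_image w)"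

lemma const_pos: "0 < N" using N by linarith

lemma geodesic: "geodesic_tree M" using M by (simp add: geodesic_trees_def)

lemma len_pos: "0 < cell_length a w" using cell_bounds(2)[OF a, of w] by simp

lemma image_length_bounds: "cell_length a w / N \<le> image_length w" "image_length w \<le> N * cell_length a w"
proof -
  let ?l = "River (left_end a w) 0" and ?r = "River (right_end a w) 0"
  have "?l \<in> T_tree a c" "?r \<in> T_tree a c"
    using cell_bounds[OF a, of w] by (auto simp: mem_T_tree)
  moreover have "dist ?l ?r = cell_length a w" using cell_bounds(2)[OF a, of w] by (simp add: dist_river_def)
  ultimately show "cell_length a w / N \<le> image_length w" "image_length w \<le> N * cell_length a w"
    using f unfolding bi_Lipschitz_const_def image_length_def left_image_def right_image_def by metis+
qed

lemma image_length_pos: "0 < image_length w"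
proof -
  have "0 < cell_length a w / N" using len_pos const_pos by simp
  then show ?thesis using image_length_bounds(1)[of w] by linarith
qed

lemma child_ends:
  "left_image (0 # w) = left_image w" "left_image (1 # w) = right_image (0 # w)" "left_image (2 # w) = right_image (1 # w)" "right_image (2 # w) = right_image w"
  by (simp_all add: left_image_def right_image_def Let_def)

lemma child_lengths:
  "cell_length a (0 # w) = a * cell_length a w"
  "cell_length a (1 # w) = (1 - 2 * a) * cell_length a w"
  "cell_length a (2 # w) = a * cell_length a w"
  by (simp_all add: Let_def algebra_simps)

lemma inner_points:
  "left_end a w < right_end a (0 # w)" "right_end a (0 # w) < left_end a (2 # w)" "left_end a (2 # w) < right_end a w"
  using cell_bounds(2)[OF a, of "0 # w"] cell_bounds(2)[OF a, of "1 # w"] cell_bounds(2)[OF a, of "2 # w"]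
  by (simp_all add: Let_def)

lemma image_length_split:
  "image_length (0 # w) + dist (right_image (0 # w)) (right_image w) = image_length w"
  "image_length (1 # w) + image_length (2 # w) = dist (right_image (0 # w)) (right_image w)"
  "dist (left_image w) (left_image (2 # w)) + image_length (2 # w) = image_length w"
proof -
  note add = river_dist_additive[OF geodesic f const_pos]
  note b = cell_bounds[OF a, of w] inner_points[of w]
  show "image_length (0 # w) + dist (right_image (0 # w)) (right_image w) = image_length w"
    unfolding image_length_def child_ends unfolding left_image_def right_image_def
    by (rule add) (use b in linarith)+
  show "image_length (1 # w) + image_length (2 # w) = dist (right_image (0 # w)) (right_image w)"
    unfolding image_length_def child_ends(2,4) unfolding child_ends(3)[symmetric] unfolding left_image_def right_image_def
    by (rule add) (use b in linarith)+
  show "dist (left_image w) (left_image (2 # w)) + image_length (2 # w) = image_length w"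
    unfolding image_length_def child_ends(4) unfolding left_image_def right_image_def
    by (rule add) (use b in linarith)+
qed

lemma image_length_children: "image_length (0 # w) + image_length (1 # w) + image_length (2 # w) = image_length w"
  using image_length_split[of w] by linarith

lemma ex_sup_stretch:
  "\<exists>S>0. (\<forall>w. image_length w \<le> S * cell_length a w) \<and> (\<forall>\<kappa>>1. \<exists>w. S * cell_length a w \<le> \<kappa> * image_length w)"
proof -
  define X where "X w = image_length w / cell_length a w" for w
  have X0: "0 < X w" for w unfolding X_def using image_length_pos len_pos by simp
  have XN: "X w \<le> N" for w unfolding X_def using image_length_bounds(2)[of w] len_pos[of w] by (simp add: divide_le_eq)
  then have bdd: "bdd_above (range X)" by (intro bdd_aboveI[of _ N]) auto
  define S where "S = Sup (range X)"
  have XS: "X w \<le> S" for w unfolding S_def using bdd by (intro cSup_upper) auto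
  show ?thesis
  proof (intro exI[of _ S] conjI allI impI)
    show S0: "0 < S" using X0 XS by (rule less_le_trans)
    show "image_length w \<le> S * cell_length a w" for w
      using XS[of w] len_pos[of w] by (simp add: X_def divide_le_eq)
    fix \<kappa> :: real assume "1 < \<kappa>"
    then have "S / \<kappa> < Sup (range X)" using S0 by (simp add: S_def[symmetric] divide_less_eq)
    then obtain w where "S / \<kappa> < X w" using less_cSup_iff[OF _ bdd] by auto
    then have "S < \<kappa> * X w" using \<open>1 < \<kappa>\<close> by (simp add: divide_less_eq mult.commute)
    then have "S * cell_length a w < \<kappa> * X w * cell_length a w" using len_pos by (intro mult_strict_right_mono)
    also have "\<dots> = \<kappa> * image_length w" using len_pos[of w] by (simp add: X_def)
    finally show "\<exists>w. S * cell_length a w \<le> \<kappa> * image_length w" by (intro exI[of _ w]) simp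
  qed
qed

lemma nearly_affine:
  assumes S: "\<And>w. image_length w \<le> S * cell_length a w" and near: "S * cell_length a w \<le> (1 + \<eta>) * image_length w" and \<eta>: "0 \<le> \<eta>"
  shows "\<bar>image_length (0 # w) - a * image_length w\<bar> \<le> \<eta> * image_length w" "\<bar>image_length (2 # w) - a * image_length w\<bar> \<le> \<eta> * image_length w"
proof -
  \<comment> \<open>No child is stretched by much more than the cell itself; the lower bounds follow because the
    image lengths of the children add up.\<close>
  have up: "image_length v \<le> p * image_length w + p * (\<eta> * image_length w)" if "cell_length a v = p * cell_length a w" "0 \<le> p" for v p
  proof -
    have "image_length v \<le> p * (S * cell_length a w)" using S[of v] that by (simp add: mult.left_commute)
    also have "\<dots> \<le> p * ((1 + \<eta>) * image_length w)" using near that(2) by (rule mult_left_mono)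
    finally show ?thesis by (simp add: algebra_simps)
  qed
  have e0: "0 \<le> \<eta> * image_length w" using \<eta> image_length_pos[of w] by simp
  have "0 \<le> a" "0 \<le> 1 - 2 * a" using a by auto
  note up0 = up[OF child_lengths(1) this(1)] and up1 = up[OF child_lengths(2) this(2)] and up2 = up[OF child_lengths(3) this(1)]
  have ae: "a * (\<eta> * image_length w) \<le> \<eta> * image_length w" "0 \<le> a * (\<eta> * image_length w)" using a e0 by (auto simp: mult_left_le_one_le)
  have "(1 - 2 * a) * image_length w = image_length w - 2 * (a * image_length w)" "(1 - 2 * a) * (\<eta> * image_length w) = \<eta> * image_length w - 2 * (a * (\<eta> * image_length w))"
    by (simp_all add: algebra_simps)
  with up0 up1 up2 image_length_children[of w] ae
  show "\<bar>image_length (0 # w) - a * image_length w\<bar> \<le> \<eta> * image_length w" "\<bar>image_length (2 # w) - a * image_length w\<bar> \<le> \<eta> * image_length w"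
    by (auto simp: abs_le_iff)
qed

lemma inner_branch_points:
  assumes x: "x \<in> {right_end a (0 # w), left_end a (2 # w)}"
  shows "f (River x 0) \<in> branch_points M" "c / (4 * N * N) * image_length w \<le> branch_height M (f (River x 0))"
proof -
  have b: "birth a (Suc (length w)) x (cell_length a w)" using cell_inner_births[of a w] x by auto
  note B = birth_image_branch_point[OF M f const_pos a c b]
  show "f (River x 0) \<in> branch_points M" by (rule B(1))
  have "c / (4 * N * N) * image_length w \<le> c / (4 * N * N) * (N * cell_length a w)"
    using image_length_bounds(2) c const_pos by (intro mult_left_mono) auto
  also have "\<dots> = c * cell_length a w / (4 * N)" using const_pos by simp
  finally show "c / (4 * N * N) * image_length w \<le> branch_height M (f (River x 0))" using B(2) by linarith
qed

lemma end_branch_points: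
  "left_image w \<in> branch_points M \<and> 0 < branch_height M (left_image w)" "right_image w \<in> branch_points M \<and> 0 < branch_height M (right_image w)"
proof -
  have *: "f (River x 0) \<in> branch_points M \<and> 0 < branch_height M (f (River x 0))" if "birth a k x e" for k x e
  proof -
    have "0 < c * e / (4 * N)" using birth_bounds(1)[OF a that] c const_pos by simp
    then show ?thesis using birth_image_branch_point[OF M f const_pos a c that] by linarith
  qed
  show "left_image w \<in> branch_points M \<and> 0 < branch_height M (left_image w)" "right_image w \<in> branch_points M \<and> 0 < branch_height M (right_image w)"
    using cell_end_births[of a w] * unfolding left_image_def right_image_def by blast+
qed

end

text \<open>Both points are branch points of \<open>M\<close> whose heights are comparable to the size of the cell; by
  relative separation they cannot be close to each other without being equal.\<close>

lemma inner_points_coincide: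
  assumes A: "T_tree_embedding M n c\<^sub>M c N a f" and B: "T_tree_embedding M n c\<^sub>M c N b g"
    and ends: "T_tree_embedding.left_image a f w = T_tree_embedding.left_image b g w" "T_tree_embedding.right_image a f w = T_tree_embedding.right_image b g w"
    and x: "x \<in> {right_end a (0 # w), left_end a (2 # w)}" and y: "y \<in> {right_end b (0 # w), left_end b (2 # w)}"
    and near: "\<bar>dist (T_tree_embedding.left_image a f w) (f (River x 0)) - dist (T_tree_embedding.left_image b g w) (g (River y 0))\<bar>
      < c\<^sub>M * (c / (4 * N * N)) * T_tree_embedding.image_length a f w"
  shows "f (River x 0) = g (River y 0)"
proof (rule ccontr)
  assume neq: "f (River x 0) \<noteq> g (River y 0)"
  interpret A: T_tree_embedding M n c\<^sub>M c N a f by (rule A)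
  interpret B: T_tree_embedding M n c\<^sub>M c N b g by (rule B)
  have meq: "A.image_length w = B.image_length w" using ends by (simp add: A.image_length_def B.image_length_def)
  have xy: "x \<in> {left_end a w..right_end a w}" "y \<in> {left_end b w..right_end b w}"
    using x y A.inner_points[of w] B.inner_points[of w] by auto
  have "dist (f (River x 0)) (g (River y 0)) = \<bar>dist (A.left_image w) (f (River x 0)) - dist (B.left_image w) (g (River y 0))\<bar>"
    unfolding A.left_image_def B.left_image_def
    by (rule river_dist_same_ends[OF A.geodesic A.f A.const_pos _ _ _ xy(1) B.f _ _ _ xy(2)])
      (use cell_bounds[OF A.a, of w] cell_bounds[OF B.a, of w] ends in \<open>auto simp: A.left_image_def B.left_image_def A.right_image_def B.right_image_def\<close>)
  moreover have "c\<^sub>M * min (branch_height M (f (River x 0))) (branch_height M (g (River y 0))) \<le> dist (f (River x 0)) (g (River y 0))"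
    using A.M A.inner_branch_points(1)[OF x] B.inner_branch_points(1)[OF y] neq by (simp add: geodesic_trees_def)
  moreover have "c\<^sub>M * (c / (4 * N * N) * A.image_length w) \<le> c\<^sub>M * min (branch_height M (f (River x 0))) (branch_height M (g (River y 0)))"
    using A.inner_branch_points(2)[OF x] B.inner_branch_points(2)[OF y] A.c\<^sub>M unfolding meq by (intro mult_left_mono) auto
  ultimately show False using near by (simp add: mult.assoc)
qed

text \<open>On cells where both embeddings are nearly affine, the subdivision points of the cell divide its
  image nearly in the ratios given by \<open>a\<close> and by \<open>b\<close>. As \<open>a\<close> and \<open>b\<close> are close, their images
  are close and therefore equal.\<close>

lemma matching_passes_to_children:
  assumes A: "T_tree_embedding M n c\<^sub>M c N a f" and B: "T_tree_embedding M n c\<^sub>M c N b g"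
    and ends: "T_tree_embedding.left_image a f w = T_tree_embedding.left_image b g w" "T_tree_embedding.right_image a f w = T_tree_embedding.right_image b g w"
    and S: "\<And>w. T_tree_embedding.image_length a f w \<le> S * cell_length a w" "S * cell_length a w \<le> (1 + \<eta>) * T_tree_embedding.image_length a f w"
    and S': "\<And>w. T_tree_embedding.image_length b g w \<le> S' * cell_length b w" "S' * cell_length b w \<le> (1 + \<eta>) * T_tree_embedding.image_length b g w"
    and \<eta>: "0 \<le> \<eta>" "\<bar>a - b\<bar> + 2 * \<eta> < c\<^sub>M * (c / (4 * N * N))"
    and i: "i \<in> {0, 1, 2}"
  shows "T_tree_embedding.left_image a f (i # w) = T_tree_embedding.left_image b g (i # w)"
    "T_tree_embedding.right_image a f (i # w) = T_tree_embedding.right_image b g (i # w)"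
proof -
  interpret A: T_tree_embedding M n c\<^sub>M c N a f by (rule A)
  interpret B: T_tree_embedding M n c\<^sub>M c N b g by (rule B)
  have meq: "A.image_length w = B.image_length w" using ends by (simp add: A.image_length_def B.image_length_def)
  have close: "\<bar>u - v\<bar> < c\<^sub>M * (c / (4 * N * N)) * A.image_length w"
    if "\<bar>u - a * A.image_length w\<bar> \<le> \<eta> * A.image_length w" "\<bar>v - b * B.image_length w\<bar> \<le> \<eta> * B.image_length w" for u v
  proof -
    have "\<bar>u - v\<bar> \<le> \<bar>a * A.image_length w - b * A.image_length w\<bar> + 2 * (\<eta> * A.image_length w)" using that unfolding meq by linarith
    also have "\<bar>a * A.image_length w - b * A.image_length w\<bar> = \<bar>a - b\<bar> * A.image_length w"
      using A.image_length_pos[of w] by (simp add: left_diff_distrib[symmetric] abs_mult)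
    also have "\<bar>a - b\<bar> * A.image_length w + 2 * (\<eta> * A.image_length w) = (\<bar>a - b\<bar> + 2 * \<eta>) * A.image_length w" by (simp add: algebra_simps)
    also have "\<dots> < c\<^sub>M * (c / (4 * N * N)) * A.image_length w" using \<eta>(2) A.image_length_pos by (rule mult_strict_right_mono)
    finally show ?thesis .
  qed
  have "\<bar>A.image_length (0 # w) - B.image_length (0 # w)\<bar> < c\<^sub>M * (c / (4 * N * N)) * A.image_length w"
    by (rule close[OF A.nearly_affine(1)[OF S \<eta>(1)] B.nearly_affine(1)[OF S' \<eta>(1)]])
  then have 0: "A.right_image (0 # w) = B.right_image (0 # w)"
    unfolding A.right_image_def B.right_image_def using A.child_ends(1)[of w] B.child_ends(1)[of w]
    by (intro inner_points_coincide[OF A B ends]) (auto simp: A.image_length_def B.image_length_def A.right_image_def B.right_image_def simp del: cell.simps)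
  have "\<bar>A.image_length (2 # w) - B.image_length (2 # w)\<bar> < c\<^sub>M * (c / (4 * N * N)) * A.image_length w"
    by (rule close[OF A.nearly_affine(2)[OF S \<eta>(1)] B.nearly_affine(2)[OF S' \<eta>(1)]])
  then have "\<bar>dist (A.left_image w) (A.left_image (2 # w)) - dist (B.left_image w) (B.left_image (2 # w))\<bar> < c\<^sub>M * (c / (4 * N * N)) * A.image_length w"
    using A.image_length_split(3)[of w] B.image_length_split(3)[of w] meq by linarith
  then have 2: "A.left_image (2 # w) = B.left_image (2 # w)"
    unfolding A.left_image_def[of "2 # w"] B.left_image_def[of "2 # w"]
    by (intro inner_points_coincide[OF A B ends]) (auto simp del: cell.simps)
  show "A.left_image (i # w) = B.left_image (i # w)" "A.right_image (i # w) = B.right_image (i # w)"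
    using i 0 2 ends A.child_ends[of w] B.child_ends[of w] by (auto simp del: One_nat_def)
qed

text \<open>Otherwise every \<open>m i\<close> would be less than the corresponding share
  \<open>sqrt (p i * q i) / \<rho>\<close> of the total, but these shares add up to at most 1.\<close>

lemma ex_increasing_child:
  fixes m p q :: "nat \<Rightarrow> real"
  assumes m: "\<And>i. i \<in> {0,1,2} \<Longrightarrow> 0 < m i" and p: "\<And>i. i \<in> {0,1,2} \<Longrightarrow> 0 \<le> p i * q i"
    and \<rho>: "sqrt (p 0 * q 0) + sqrt (p 1 * q 1) + sqrt (p 2 * q 2) \<le> \<rho>" "0 < \<rho>"
  shows "\<exists>i\<in>{0,1,2}. (m 0 + m 1 + m 2)\<^sup>2 * (p i * q i) \<le> \<rho>\<^sup>2 * (m i)\<^sup>2"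
proof (rule ccontr)
  assume no: "\<not> ?thesis"
  define s where "s = m 0 + m 1 + m 2"
  have s: "0 < s" using m[of 0] m[of 1] m[of 2] by (simp add: s_def)
  have "\<rho> * m i < s * sqrt (p i * q i)" if i: "i \<in> {0,1,2}" for i
  proof (rule power2_less_imp_less)
    have "\<rho>\<^sup>2 * (m i)\<^sup>2 < s\<^sup>2 * (p i * q i)" using no i unfolding s_def by force
    then show "(\<rho> * m i)\<^sup>2 < (s * sqrt (p i * q i))\<^sup>2" using p[OF i] by (simp add: power_mult_distrib)
    show "0 \<le> s * sqrt (p i * q i)" using s p[OF i] by simp
  qed
  from this[of 0] this[of 1] this[of 2]
  have "\<rho> * s < s * (sqrt (p 0 * q 0) + sqrt (p 1 * q 1) + sqrt (p 2 * q 2))"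
    by (simp add: s_def algebra_simps)
  also have "\<dots> \<le> s * \<rho>" using \<rho>(1) s by (intro mult_left_mono) auto
  finally show False by simp
qed

text \<open>The left-hand side is the Hellinger affinity of the two subdivisions \<open>(a, 1 - 2 * a, a)\<close> and
  \<open>(b, 1 - 2 * b, b)\<close>, regarded as probability vectors. The strict inequality is the source of the
  contradiction between different parameters.\<close>

lemma hellinger_affinity_less_one:
  fixes a b :: real
  assumes "a \<noteq> b" "0 < a" "0 < b" "a \<le> 1/3" "b \<le> 1/3"
  shows "2 * sqrt (a * b) + sqrt ((1 - 2 * a) * (1 - 2 * b)) < 1"
proof -
  have "0 < (a - b)\<^sup>2" using assms(1) by simp
  then have "4 * (a * b) < (a + b)\<^sup>2" by (simp add: power2_eq_square algebra_simps)
  then have "sqrt (a * b) < (a + b) / 2" using assms by (intro real_less_lsqrt) (auto simp: power_divide)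
  moreover have "sqrt ((1 - 2 * a) * (1 - 2 * b)) \<le> ((1 - 2 * a) + (1 - 2 * b)) / 2"
    using assms by (intro arith_geo_mean_sqrt) auto
  ultimately show ?thesis by (simp add: field_simps)
qed

text \<open>Suppose \<open>a \<noteq> b\<close>. Consider the quantity \<open>(image_length w)\<^sup>2 / (cell_length a w * cell_length b w)\<close>,
  the product of the two stretch factors, on cells \<open>w\<close> that both embeddings map to the same arc. If
  it is almost as large as the product \<open>S * S'\<close> of the suprema, then each of the two stretch factors
  is almost as large as its own supremum, so the matching passes to the three children; and some
  child increases the quantity by the factor \<open>\<sigma> = 1 / \<rho>\<^sup>2 > 1\<close>. The hypotheses on \<open>w0\<close> say that
  this can be started, and iterating it exceeds the bound \<open>S * S'\<close>.\<close>

lemma common_data_determines_parameter: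
  assumes A: "T_tree_embedding M n c\<^sub>M c N a f" and B: "T_tree_embedding M n c\<^sub>M c N b g"
    and ends: "T_tree_embedding.left_image a f w0 = T_tree_embedding.left_image b g w0" "T_tree_embedding.right_image a f w0 = T_tree_embedding.right_image b g w0"
    and S: "\<And>w. T_tree_embedding.image_length a f w \<le> S * cell_length a w" "S * cell_length a w0 \<le> \<kappa> * T_tree_embedding.image_length a f w0"
    and S': "\<And>w. T_tree_embedding.image_length b g w \<le> S' * cell_length b w" "S' * cell_length b w0 \<le> \<kappa> * T_tree_embedding.image_length b g w0"
    and pos: "0 < S" "0 < S'" "0 \<le> \<kappa>"
    and \<eta>: "\<kappa> * \<kappa> = 1 + \<eta>" "0 \<le> \<eta>" "\<bar>a - b\<bar> + 2 * \<eta> < c\<^sub>M * (c / (4 * N * N))"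
  shows "a = b"
proof (rule ccontr)
  assume ab: "a \<noteq> b"
  interpret A: T_tree_embedding M n c\<^sub>M c N a f by (rule A)
  interpret B: T_tree_embedding M n c\<^sub>M c N b g by (rule B)
  define p where "p i = (if i = 1 then 1 - 2 * a else a)" for i :: nat
  define q where "q i = (if i = 1 then 1 - 2 * b else b)" for i :: nat
  define \<rho> where "\<rho> = 2 * sqrt (a * b) + sqrt ((1 - 2 * a) * (1 - 2 * b))"
  have a0: "0 < a" "0 < b" using A.a B.a by auto
  have pq: "0 < p i" "0 < q i" for i using A.a B.a by (auto simp: p_def q_def)
  have \<rho>1: "\<rho> < 1" unfolding \<rho>_def using ab a0 A.a B.a by (intro hellinger_affinity_less_one) auto
  have \<rho>0: "0 < \<rho>" unfolding \<rho>_def using a0 A.a B.a by (intro add_pos_nonneg) auto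
  define \<sigma> where "\<sigma> = 1 / \<rho>\<^sup>2"
  have \<sigma>1: "1 < \<sigma>" unfolding \<sigma>_def using \<rho>0 \<rho>1 by (simp add: power_less_one_iff)
  have lens: "cell_length a (i # w) = p i * cell_length a w" "cell_length b (i # w) = q i * cell_length b w"
    if "i \<in> {0,1,2}" for i w
    using that A.child_lengths[of w] B.child_lengths[of w] by (auto simp: p_def q_def simp del: cell.simps)
  define E where "E w = cell_length a w * cell_length b w" for w
  have E0: "0 < E w" for w unfolding E_def using A.len_pos B.len_pos by simp
  have EC: "E (i # w) = p i * q i * E w" if "i \<in> {0,1,2}" for i w
    unfolding E_def lens[OF that] by simp
  \<comment> \<open>The threshold above which the matching passes to the children.\<close>
  define X where "X = S * S' / (1 + \<eta>)"
  have X0: "0 < X" unfolding X_def using pos \<eta>(2) by simp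
  have start: "X * E w0 \<le> (A.image_length w0)\<^sup>2"
  proof -
    have meq: "A.image_length w0 = B.image_length w0" using ends by (simp add: A.image_length_def B.image_length_def)
    have "(S * cell_length a w0) * (S' * cell_length b w0) \<le> (\<kappa> * A.image_length w0) * (\<kappa> * B.image_length w0)"
    proof (rule mult_mono[OF S(2) S'(2)])
      show "0 \<le> \<kappa> * A.image_length w0" using pos A.image_length_pos[of w0] by simp
      show "0 \<le> S' * cell_length b w0" using pos B.len_pos[of w0] by simp
    qed
    then have "S * S' * E w0 \<le> (\<kappa> * \<kappa>) * (A.image_length w0)\<^sup>2" unfolding meq E_def by (simp add: power2_eq_square mult_ac)
    then show ?thesis unfolding X_def \<eta>(1) using \<eta>(2) by (simp add: divide_le_eq mult.commute)
  qed
  have "\<exists>w. A.left_image w = B.left_image w \<and> A.right_image w = B.right_image w \<and> X * \<sigma> ^ k * E w \<le> (A.image_length w)\<^sup>2" for k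
  proof (induction k)
    case 0
    then show ?case using ends start by auto
  next
    case (Suc k)
    then obtain w where w: "A.left_image w = B.left_image w" "A.right_image w = B.right_image w" "X * \<sigma> ^ k * E w \<le> (A.image_length w)\<^sup>2" by blast
    have meq: "A.image_length w = B.image_length w" using w by (simp add: A.image_length_def B.image_length_def)
    have "1 \<le> \<sigma> ^ k" using \<sigma>1 by simp
    then have "X * E w * 1 \<le> X * E w * \<sigma> ^ k" using X0 E0[of w] by (intro mult_left_mono) auto
    then have "X * E w \<le> (A.image_length w)\<^sup>2" using w(3) by (simp add: mult_ac)
    then have prod: "(S * cell_length a w) * (S' * cell_length b w) \<le> (1 + \<eta>) * A.image_length w * B.image_length w"
      using \<eta>(2) unfolding X_def E_def meq by (simp add: divide_le_eq power2_eq_square mult_ac)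
    have nearA: "S * cell_length a w \<le> (1 + \<eta>) * A.image_length w"
    proof (rule mult_right_le_imp_le)
      have "S * cell_length a w * B.image_length w \<le> S * cell_length a w * (S' * cell_length b w)"
        using S'(1) pos A.len_pos[of w] by (intro mult_left_mono) auto
      then show "S * cell_length a w * B.image_length w \<le> (1 + \<eta>) * A.image_length w * B.image_length w" using prod by linarith
    qed (rule B.image_length_pos)
    have nearB: "S' * cell_length b w \<le> (1 + \<eta>) * B.image_length w"
    proof (rule mult_right_le_imp_le)
      have "A.image_length w * (S' * cell_length b w) \<le> (S * cell_length a w) * (S' * cell_length b w)"
        using S(1) pos B.len_pos[of w] by (intro mult_right_mono) auto
      then show "S' * cell_length b w * A.image_length w \<le> (1 + \<eta>) * B.image_length w * A.image_length w" using prod by (simp add: mult_ac)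
    qed (rule A.image_length_pos)
    note child = matching_passes_to_children[OF A B w(1,2) S(1) nearA S'(1) nearB \<eta>(2,3)]
    have "\<exists>i\<in>{0,1,2}. (A.image_length (0 # w) + A.image_length (1 # w) + A.image_length (2 # w))\<^sup>2 * (p i * q i) \<le> \<rho>\<^sup>2 * (A.image_length (i # w))\<^sup>2"
      by (rule ex_increasing_child[where m = "\<lambda>i. A.image_length (i # w)"])
        (use A.image_length_pos pq[THEN less_imp_le] \<rho>0 in \<open>auto simp: \<rho>_def p_def q_def simp del: One_nat_def\<close>)
    then obtain i where i: "i \<in> {0,1,2}" "(A.image_length w)\<^sup>2 * (p i * q i) \<le> \<rho>\<^sup>2 * (A.image_length (i # w))\<^sup>2"
      unfolding A.image_length_children by blast
    have "X * \<sigma> ^ k * E w * (p i * q i) \<le> (A.image_length w)\<^sup>2 * (p i * q i)"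
      using w(3) pq[of i] by (intro mult_right_mono) auto
    then have "X * \<sigma> ^ k * E (i # w) \<le> \<rho>\<^sup>2 * (A.image_length (i # w))\<^sup>2"
      using i(2) unfolding EC[OF i(1)] by (simp add: mult_ac)
    then have "X * \<sigma> ^ k * E (i # w) / \<rho>\<^sup>2 \<le> (A.image_length (i # w))\<^sup>2"
      using \<rho>0 by (simp add: divide_le_eq mult.commute)
    then have "X * \<sigma> ^ Suc k * E (i # w) \<le> (A.image_length (i # w))\<^sup>2" by (simp add: \<sigma>_def mult_ac)
    then show ?case using child[OF i(1)] by blast
  qed
  moreover obtain k where k: "S * S' / X < \<sigma> ^ k" using real_arch_pow[OF \<sigma>1] by blast
  ultimately obtain w where w: "A.left_image w = B.left_image w" "A.right_image w = B.right_image w" "X * \<sigma> ^ k * E w \<le> (A.image_length w)\<^sup>2" by blast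
  have meq: "A.image_length w = B.image_length w" using w by (simp add: A.image_length_def B.image_length_def)
  have "(A.image_length w)\<^sup>2 \<le> (S * cell_length a w) * (S' * cell_length b w)"
    unfolding power2_eq_square using S(1)[of w] S'(1)[of w] A.image_length_pos[of w] B.image_length_pos[of w] unfolding meq
    by (intro mult_mono) auto
  then have "X * \<sigma> ^ k * E w \<le> S * S' * E w" using w(3) by (simp add: E_def mult_ac)
  then have "X * \<sigma> ^ k \<le> S * S'" using E0[of w] by simp
  moreover have "S * S' < X * \<sigma> ^ k" using k X0 by (simp add: divide_less_eq mult.commute)
  ultimately show False by simp
qed

text \<open>To each parameter attach a Lipschitz constant \<open>N\<close>, the position of the parameter in a grid of
  small mesh, a cell that is stretched almost maximally, and the images of the ends of this cell.
  These data range over a countable set, since the images are branch points of \<open>M\<close>, and they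
  determine the parameter.\<close>

lemma countable_embeddable_parameters:
  fixes M :: "'image_length::metric_space set"
  assumes M: "M \<in> geodesic_trees n c\<^sub>M" and c\<^sub>M: "0 < c\<^sub>M" and c: "0 < c" "c < 1"
  shows "countable {a \<in> {1/4..1/3}. \<exists>f. bi_Lipschitz_embedding (T_tree a c) M f}" (is "countable ?A")
proof -
  define Z where "Z = {p \<in> branch_points M. 0 < branch_height M p}"
  have Z: "countable Z" unfolding Z_def by (rule countable_branch_points[OF M c\<^sub>M])
  \<comment> \<open>Distinct branch points of M that come from subdividing a cell with image length m have distance
    at least \<open>\<theta> N * m\<close>. Half of this is spent on the deviation from affine maps, and a quarter on the
    difference of the parameters.\<close>
  define \<theta> where "\<theta> N = c\<^sub>M * (c / (4 * real N * real N))" for N :: nat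
  define \<kappa> where "\<kappa> N = sqrt (1 + \<theta> N / 4)" for N
  define data where "data a d \<longleftrightarrow> (case d of (N, k, w, p, q) \<Rightarrow>
     1 \<le> N \<and> k = \<lfloor>a / (\<theta> N / 4)\<rfloor> \<and>
     (\<exists>f S. T_tree_embedding M n c\<^sub>M c (real N) a f \<and> 0 < S \<and> (\<forall>w. T_tree_embedding.image_length a f w \<le> S * cell_length a w) \<and>
        S * cell_length a w \<le> \<kappa> N * T_tree_embedding.image_length a f w \<and>
        p = T_tree_embedding.left_image a f w \<and> q = T_tree_embedding.right_image a f w))"
    for a and d :: "nat \<times> int \<times> nat list \<times> 'image_length \<times> 'image_length"
  have \<theta>0: "0 < \<theta> N" if "1 \<le> N" for N unfolding \<theta>_def using c\<^sub>M c that by simp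
  have ex: "\<exists>d. data a d \<and> d \<in> UNIV \<times> UNIV \<times> UNIV \<times> Z \<times> Z" if a: "a \<in> ?A" for a
  proof -
    obtain f where "bi_Lipschitz_embedding (T_tree a c) M f" using a by blast
    then obtain N :: nat where N1: "1 \<le> N" "bi_Lipschitz_const (real N) (T_tree a c) M f"
      using bi_Lipschitz_embedding_const by metis
    interpret T_tree_embedding M n c\<^sub>M c "real N" a f
      by unfold_locales (use assms N1 a in auto)
    obtain S where S: "0 < S" "\<And>w. image_length w \<le> S * cell_length a w"
      "\<And>\<kappa>. 1 < \<kappa> \<Longrightarrow> \<exists>w. S * cell_length a w \<le> \<kappa> * image_length w"
      using ex_sup_stretch by blast
    have "1 < \<kappa> N" unfolding \<kappa>_def using \<theta>0[OF N1(1)] by simp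
    then obtain w where w: "S * cell_length a w \<le> \<kappa> N * image_length w" using S(3) by blast
    have "data a (N, \<lfloor>a / (\<theta> N / 4)\<rfloor>, w, left_image w, right_image w)"
      unfolding data_def prod.case using N1(1) S(1,2) w T_tree_embedding_axioms by blast
    moreover have "left_image w \<in> Z" "right_image w \<in> Z" using end_branch_points[of w] by (auto simp: Z_def)
    ultimately show ?thesis by blast
  qed
  have uniq: "a = b" if a: "data a d" and b: "data b d" for a b d
  proof -
    obtain N k w p q where d: "d = (N, k, w, p, q)" by (cases d)
    obtain f S where f: "T_tree_embedding M n c\<^sub>M c (real N) a f" "0 < S" "\<And>w. T_tree_embedding.image_length a f w \<le> S * cell_length a w"
        "S * cell_length a w \<le> \<kappa> N * T_tree_embedding.image_length a f w"
        "p = T_tree_embedding.left_image a f w" "q = T_tree_embedding.right_image a f w"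
      using a unfolding data_def d prod.case by blast
    obtain g S' where g: "T_tree_embedding M n c\<^sub>M c (real N) b g" "0 < S'" "\<And>w. T_tree_embedding.image_length b g w \<le> S' * cell_length b w"
        "S' * cell_length b w \<le> \<kappa> N * T_tree_embedding.image_length b g w"
        "p = T_tree_embedding.left_image b g w" "q = T_tree_embedding.right_image b g w"
      using b unfolding data_def d prod.case by blast
    have N: "1 \<le> N" "\<lfloor>a / (\<theta> N / 4)\<rfloor> = \<lfloor>b / (\<theta> N / 4)\<rfloor>" using a b unfolding data_def d prod.case by auto
    have "\<bar>a / (\<theta> N / 4) - b / (\<theta> N / 4)\<bar> < 1" using N(2) by linarith
    then have "\<bar>a * 4 - b * 4\<bar> < \<theta> N"
      using \<theta>0[OF N(1)] by (simp add: diff_divide_distrib[symmetric] abs_divide divide_less_eq)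
    then have "\<bar>a - b\<bar> + 2 * (\<theta> N / 4) < \<theta> N" using \<theta>0[OF N(1)] by linarith
    moreover have "\<kappa> N * \<kappa> N = 1 + \<theta> N / 4" "0 \<le> \<kappa> N" "0 \<le> \<theta> N / 4"
      using \<theta>0[OF N(1)] by (simp_all add: \<kappa>_def)
    moreover have "T_tree_embedding.left_image a f w = T_tree_embedding.left_image b g w" "T_tree_embedding.right_image a f w = T_tree_embedding.right_image b g w"
      using f(5,6) g(5,6) by simp_all
    ultimately show "a = b"
      unfolding \<theta>_def[of N]
      by (intro common_data_determines_parameter[OF f(1) g(1) _ _ f(3,4) g(3,4) f(2) g(2)])
  qed
  define D where "D a = (SOME d. data a d \<and> d \<in> UNIV \<times> UNIV \<times> UNIV \<times> Z \<times> Z)" for a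
  have D: "data a (D a) \<and> D a \<in> UNIV \<times> UNIV \<times> UNIV \<times> Z \<times> Z" if "a \<in> ?A" for a
    unfolding D_def using ex[OF that] by (rule someI_ex)
  have "inj_on D ?A"
  proof (rule inj_onI)
    fix a b assume "a \<in> ?A" "b \<in> ?A" "D a = D b"
    then show "a = b" using uniq[of a "D a" b] D[of a] D[of b] by simp
  qed
  moreover have "countable (D ` ?A)"
  proof (rule countable_subset)
    show "D ` ?A \<subseteq> UNIV \<times> UNIV \<times> UNIV \<times> Z \<times> Z" using D by blast
  qed (use Z in auto)
  ultimately show ?thesis using countable_image_inj_on by blast
qed

theorem theorem1p1:
  fixes n n\<^sub>M :: nat and c c\<^sub>M :: real and M :: "'m::metric_space set"
  assumes "n \<ge> 3" and "0 < c" and "c < 1"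
    and "n\<^sub>M \<ge> 3" and "0 < c\<^sub>M" and "c\<^sub>M < 1"
    and "M \<in> geodesic_trees n\<^sub>M c\<^sub>M"
  shows "countable {a \<in> {1/4..1/3}. \<exists>f. bi_Lipschitz_embedding (T_tree a c) M f} \<and>
         (\<forall>a \<in> {1/4..1/3}. T_tree a c \<in> geodesic_trees n c)"
proof (intro conjI ballI)
  show "countable {a \<in> {1/4..1/3}. \<exists>f. bi_Lipschitz_embedding (T_tree a c) M f}"
    using assms by (intro countable_embeddable_parameters)
  show "T_tree a c \<in> geodesic_trees n c" if "a \<in> {1/4..1/3}" for a
    using assms that by (intro T_tree_in_geodesic_trees) auto
qed

end
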